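(* Let $\alpha,\beta\in\mathbb{C}$ be nonzero with $|\alpha|^2+|\beta|^2=1$ and suppose $|\beta|^2<\frac{1}{4+\gamma}$, where $\gamma$ is the unique real root of the cubic polynomial $z^3+7z^2+12z-1$. Then there exist $a\in\mathbb{C}$ with $0<|a|<1$, $a\neq\alpha\bar\beta$, and a closed $S_{\alpha,\beta}$-invariant subspace $\mathcal{M}\subseteq H^2_{\alpha,\beta}$ with associated inner function $\theta(z)=\frac{z-a}{1-\bar az}$, such that $\mathcal{M}\neq[\mathcal{M}\ominus S_{\alpha,\beta}\mathcal{M}]_{S_{\alpha,\beta}}$.
   Context: $H^2(\mathbb{D})$ is the Hardy space of the open unit disc with its usual norm $\|\cdot\|$. Put $f_0=\alpha+\beta z$ and $H^2_{\alpha,\beta}=\overline{\mathrm{span}}\{f_0,\ z^n: n\ge 2\}$, a closed subspace of $H^2(\mathbb{D})$. Let $P_{H^2_{\alpha,\beta}}$ be the orthogonal projection of $H^2(\mathbb{D})$ onto $H^2_{\alpha,\beta}$, $M_z$ multiplication by $z$ on $H^2(\mathbb{D})$, and $S_{\alpha,\beta}=P_{H^2_{\alpha,\beta}}M_z|_{H^2_{\alpha,\beta}}$. $\oplus$ denotes orthogonal direct sum and $\mathcal{M}\ominus\mathcal{N}$ the orthogonal complement of $\mathcal{N}$ in $\mathcal{M}$. For an operator $T$ and a subset $E$, $[E]_T$ is the closed linear span of $\{T^nh: h\in E,\ n\ge0\}$. A closed $S_{\alpha,\beta}$-invariant subspace $\mathcal{M}$ has associated inner function $\theta$ (with $\theta(\alpha\bar\beta)\ne0$)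 if $\mathcal{M}=\mathbb{C}f_2\oplus\mathbb{C}f_1\oplus z^3\theta H^2(\mathbb{D})$, where $g\in H^2(\mathbb{D})\ominus\theta H^2(\mathbb{D})$ satisfies $(z-\alpha\bar\beta)g(z)=\frac{\beta}{\theta(\alpha\bar\beta)}[\theta(z)-\theta(\alpha\bar\beta)]$, $f_1=\alpha\bar\beta f_0+\beta z^2+z^3g$ and $f_2=f_0+z^2g-\frac{\bar\alpha\beta}{\bar\beta}\overline{\theta(\alpha\bar\beta)}(1+\|g\|^2)z^2\theta$. *)

theory Defs
  imports "HOL-Complex_Analysis.Complex_Analysis"
begin

definition taylor_coeff :: "(complex \<Rightarrow> complex) \<Rightarrow> nat \<Rightarrow> complex" where
  "taylor_coeff f n = fps_nth (fps_expansion f 0) n"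

text \<open>
  Elements are the holomorphic functions on the disc with square-summable Taylor coefficients.
  They are made total by the value 0 outside the disc, so that equality of elements is equality
  of functions on the disc.
\<close>

definition hardy_set :: "(complex \<Rightarrow> complex) set" where
  "hardy_set = {f. f holomorphic_on ball 0 1 \<and> (\<forall>z. z \<notin> ball 0 1 \<longrightarrow> f z = 0) \<and>
                   summable (\<lambda>n. (norm (taylor_coeff f n))\<^sup>2)}"

lemma taylor_coeff_cong:
  assumes "\<And>z. z \<in> ball 0 1 \<Longrightarrow> f z = g z"
  shows "taylor_coeff f n = taylor_coeff g n"
proof -
  have "eventually (\<lambda>z. z \<in> ball (0::complex) 1) (nhds 0)"
    by (intro eventually_nhds_in_open) auto
  hence "eventually (\<lambda>z. f z = g z) (nhds 0)"
    by eventually_elim (rule assms)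
  thus ?thesis
    by (simp add: taylor_coeff_def fps_expansion_def higher_deriv_cong_ev)
qed

lemma taylor_coeff_zero [simp]: "taylor_coeff (\<lambda>_. 0) n = 0"
  by (simp add: taylor_coeff_def fps_expansion_def)

lemma taylor_coeff_add:
  assumes "f holomorphic_on ball 0 1" "g holomorphic_on ball 0 1"
  shows "taylor_coeff (\<lambda>z. f z + g z) n = taylor_coeff f n + taylor_coeff g n"
  using higher_deriv_add[OF assms, of 0 n]
  by (simp add: taylor_coeff_def fps_expansion_def add_divide_distrib)

lemma taylor_coeff_cmult:
  assumes "f holomorphic_on ball 0 1"
  shows "taylor_coeff (\<lambda>z. c * f z) n = c * taylor_coeff f n"
  using higher_deriv_cmult[OF assms, of 0 n c]
  by (simp add: taylor_coeff_def fps_expansion_def)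

lemma taylor_coeff_poly: "taylor_coeff (poly p) n = coeff p n"
proof -
  have "poly p has_fps_expansion fps_of_poly p"
    by (auto simp: has_fps_expansion_def eval_fps_of_poly)
  thus ?thesis
    by (simp add: taylor_coeff_def fps_expansion_eqI)
qed

lemma taylor_coeff_mult_z:
  assumes "f holomorphic_on ball 0 1"
  shows "taylor_coeff (\<lambda>z. z * f z) n = (case n of 0 \<Rightarrow> 0 | Suc m \<Rightarrow> taylor_coeff f m)"
proof -
  have "f has_fps_expansion fps_expansion f 0"
    using assms by (intro has_fps_expansion_fps_expansion[of "ball 0 1"]) auto
  hence "(\<lambda>z. z * f z) has_fps_expansion fps_X * fps_expansion f 0"
    by (intro fps_expansion_intros)
  thus ?thesis
    by (auto simp: taylor_coeff_def fps_expansion_eqI split: nat.splits)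
qed

lemma summable_norm_sq_add:
  fixes a b :: "nat \<Rightarrow> complex"
  assumes "summable (\<lambda>n. (norm (a n))\<^sup>2)" "summable (\<lambda>n. (norm (b n))\<^sup>2)"
  shows "summable (\<lambda>n. (norm (a n + b n))\<^sup>2)"
proof (rule summable_comparison_test')
  show "summable (\<lambda>n. 2 * ((norm (a n))\<^sup>2 + (norm (b n))\<^sup>2))"
    using assms by (intro summable_mult summable_add)
  show "norm ((norm (a n + b n))\<^sup>2) \<le> 2 * ((norm (a n))\<^sup>2 + (norm (b n))\<^sup>2)" if "n \<ge> 0" for n
  proof -
    have "(norm (a n + b n))\<^sup>2 \<le> (norm (a n) + norm (b n))\<^sup>2"
      by (intro power_mono norm_triangle_ineq) auto
    also have "\<dots> \<le> 2 * ((norm (a n))\<^sup>2 + (norm (b n))\<^sup>2)"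
      using zero_le_power2[of "norm (a n) - norm (b n)"]
      unfolding power2_sum power2_diff distrib_left by linarith
    finally show ?thesis by simp
  qed
qed

lemma summable_mult_cnj:
  fixes a b :: "nat \<Rightarrow> complex"
  assumes "summable (\<lambda>n. (norm (a n))\<^sup>2)" "summable (\<lambda>n. (norm (b n))\<^sup>2)"
  shows "summable (\<lambda>n. a n * cnj (b n))"
proof (rule summable_comparison_test')
  show "summable (\<lambda>n. (norm (a n))\<^sup>2 + (norm (b n))\<^sup>2)"
    using assms by (intro summable_add)
  show "norm (a n * cnj (b n)) \<le> (norm (a n))\<^sup>2 + (norm (b n))\<^sup>2" if "n \<ge> 0" for n
    using zero_le_power2[of "norm (a n) - norm (b n)"]
      mult_nonneg_nonneg[OF norm_ge_zero[of "a n"] norm_ge_zero[of "b n"]]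
    unfolding power2_diff norm_mult complex_mod_cnj by linarith
qed

typedef hardy = hardy_set
  morphisms hardy_fun Abs_hardy
  by (rule exI[of _ "\<lambda>_. 0"]) (simp add: hardy_set_def)

setup_lifting type_definition_hardy

abbreviation hardy_coeff :: "hardy \<Rightarrow> nat \<Rightarrow> complex" where
  "hardy_coeff f \<equiv> taylor_coeff (hardy_fun f)"

lemma hardy_fun_holomorphic: "hardy_fun f holomorphic_on ball 0 1"
  and hardy_fun_outside: "z \<notin> ball 0 1 \<Longrightarrow> hardy_fun f z = 0"
  and hardy_coeff_summable: "summable (\<lambda>n. (norm (hardy_coeff f n))\<^sup>2)"
  using hardy_fun[of f] by (auto simp: hardy_set_def)

lemma hardy_eqI:
  assumes "\<And>z. z \<in> ball 0 1 \<Longrightarrow> hardy_fun f z = hardy_fun g z"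
  shows "f = g"
proof -
  have "hardy_fun f z = hardy_fun g z" for z
    using assms hardy_fun_outside[of z f] hardy_fun_outside[of z g] by (cases "z \<in> ball 0 1") auto
  thus ?thesis
    by (metis ext hardy_fun_inject)
qed

instantiation hardy :: ab_group_add
begin

lift_definition zero_hardy :: hardy is "\<lambda>_. 0"
  by (simp add: hardy_set_def)

lift_definition plus_hardy :: "hardy \<Rightarrow> hardy \<Rightarrow> hardy" is "\<lambda>f g z. f z + g z"
  by (auto simp: hardy_set_def taylor_coeff_add intro!: holomorphic_intros summable_norm_sq_add)

lift_definition uminus_hardy :: "hardy \<Rightarrow> hardy" is "\<lambda>f z. - f z"
proof -
  fix f assume f: "f \<in> hardy_set"
  have "taylor_coeff (\<lambda>z. - f z) n = - taylor_coeff f n" for n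
    using taylor_coeff_cmult[of f "-1" n] f by (simp add: hardy_set_def)
  thus "(\<lambda>z. - f z) \<in> hardy_set"
    using f by (auto simp: hardy_set_def intro!: holomorphic_intros)
qed

definition minus_hardy :: "hardy \<Rightarrow> hardy \<Rightarrow> hardy" where
  "minus_hardy f g = f + - g"

instance
proof
  fix f g h :: hardy
  show "f + g + h = f + (g + h)" by transfer (simp add: add.assoc)
  show "f + g = g + f" by transfer (simp add: add.commute)
  show "0 + f = f" by transfer simp
  show "- f + f = 0" by transfer simp
  show "f - g = f + - g" by (rule minus_hardy_def)
qed

end

lift_definition cscale :: "complex \<Rightarrow> hardy \<Rightarrow> hardy"  (infixr "*\<^sub>C" 75) is "\<lambda>c f z. c * f z"
  by (auto simp: hardy_set_def taylor_coeff_cmult norm_mult power_mult_distrib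
      intro!: holomorphic_intros summable_mult)

interpretation hardy: vector_space cscale
proof
  fix a b :: complex and f g :: hardy
  show "a *\<^sub>C (f + g) = a *\<^sub>C f + a *\<^sub>C g" by transfer (simp add: distrib_left)
  show "(a + b) *\<^sub>C f = a *\<^sub>C f + b *\<^sub>C f" by transfer (simp add: distrib_right)
  show "a *\<^sub>C b *\<^sub>C f = (a * b) *\<^sub>C f" by transfer (simp add: mult.assoc)
  show "1 *\<^sub>C f = f" by transfer simp
qed

lemma hardy_fun_simps [simp]:
  "hardy_fun 0 z = 0"
  "hardy_fun (f + g) z = hardy_fun f z + hardy_fun g z"
  "hardy_fun (- f) z = - hardy_fun f z"
  "hardy_fun (c *\<^sub>C f) z = c * hardy_fun f z"
  by (transfer; simp)+

lemma hardy_fun_diff [simp]: "hardy_fun (f - g) z = hardy_fun f z - hardy_fun g z"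
  unfolding minus_hardy_def hardy_fun_simps by simp

lemma hardy_coeff_zero [simp]: "hardy_coeff 0 n = 0"
  by transfer simp

lemma hardy_coeff_add [simp]: "hardy_coeff (f + g) n = hardy_coeff f n + hardy_coeff g n"
  by transfer (simp add: hardy_set_def taylor_coeff_add)

lemma hardy_coeff_cscale [simp]: "hardy_coeff (c *\<^sub>C f) n = c * hardy_coeff f n"
  by transfer (simp add: hardy_set_def taylor_coeff_cmult)

lemma hardy_eq_0_iff: "f = 0 \<longleftrightarrow> (\<forall>n. hardy_coeff f n = 0)"
proof
  assume *: "\<forall>n. hardy_coeff f n = 0"
  show "f = 0"
  proof (rule hardy_eqI)
    fix z :: complex assume "z \<in> ball 0 1"
    moreover have "(deriv ^^ n) (hardy_fun f) 0 = 0" for n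
      using *[rule_format, of n] by (simp add: taylor_coeff_def fps_expansion_def)
    ultimately have "hardy_fun f z = 0"
      using holomorphic_fun_eq_0_on_ball[OF hardy_fun_holomorphic] by blast
    thus "hardy_fun f z = hardy_fun 0 z" by simp
  qed
qed auto

definition hardy_inner :: "hardy \<Rightarrow> hardy \<Rightarrow> complex" where
  "hardy_inner f g = (\<Sum>n. hardy_coeff f n * cnj (hardy_coeff g n))"

lemma hardy_inner_summable: "summable (\<lambda>n. hardy_coeff f n * cnj (hardy_coeff g n))"
  by (intro summable_mult_cnj hardy_coeff_summable)

lemma hardy_inner_commute: "hardy_inner g f = cnj (hardy_inner f g)"
proof -
  have "(\<lambda>n. cnj (hardy_coeff f n * cnj (hardy_coeff g n))) sums cnj (hardy_inner f g)"
    unfolding sums_cnj hardy_inner_def by (rule summable_sums[OF hardy_inner_summable])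
  thus ?thesis
    unfolding hardy_inner_def[of g f] by (simp add: sums_iff mult.commute)
qed

lemma hardy_inner_add_left: "hardy_inner (f + g) h = hardy_inner f h + hardy_inner g h"
  unfolding hardy_inner_def
  by (subst suminf_add) (simp_all add: hardy_inner_summable ring_distribs)

lemma hardy_inner_cscale_left: "hardy_inner (c *\<^sub>C f) g = c * hardy_inner f g"
  unfolding hardy_inner_def
  by (subst suminf_mult [symmetric]) (simp_all add: hardy_inner_summable mult.assoc)

lemma hardy_inner_self: "hardy_inner f f = of_real (\<Sum>n. (norm (hardy_coeff f n))\<^sup>2)"
  unfolding hardy_inner_def complex_norm_square [symmetric]
  by (rule suminf_of_real [symmetric]) (rule hardy_coeff_summable)

text \<open>
  The underlying real inner product space: its norm is the usual Hardy space norm, so the library's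
  topological notions on this type refer to the norm topology.
\<close>

instantiation hardy :: real_inner
begin

definition scaleR_hardy :: "real \<Rightarrow> hardy \<Rightarrow> hardy" where
  "scaleR_hardy r f = of_real r *\<^sub>C f"

definition inner_hardy :: "hardy \<Rightarrow> hardy \<Rightarrow> real" where
  "inner_hardy f g = Re (hardy_inner f g)"

definition norm_hardy :: "hardy \<Rightarrow> real" where
  "norm_hardy f = sqrt (\<Sum>n. (norm (hardy_coeff f n))\<^sup>2)"

definition sgn_hardy :: "hardy \<Rightarrow> hardy" where
  "sgn_hardy f = inverse (norm f) *\<^sub>R f"

definition dist_hardy :: "hardy \<Rightarrow> hardy \<Rightarrow> real" where
  "dist_hardy f g = norm (f - g)"

definition uniformity_hardy :: "(hardy \<times> hardy) filter" where
  "uniformity_hardy = (INF e\<in>{0 <..}. principal {(x, y). dist x y < e})"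

definition open_hardy :: "hardy set \<Rightarrow> bool" where
  "open_hardy U = (\<forall>x\<in>U. eventually (\<lambda>(x', y). x' = x \<longrightarrow> y \<in> U) uniformity)"

instance
proof
  fix f g h :: hardy and r s :: real and U :: "hardy set"
  show "r *\<^sub>R (f + g) = r *\<^sub>R f + r *\<^sub>R g"
    by (simp add: scaleR_hardy_def hardy.scale_right_distrib)
  show "(r + s) *\<^sub>R f = r *\<^sub>R f + s *\<^sub>R f"
    by (simp add: scaleR_hardy_def hardy.scale_left_distrib)
  show "r *\<^sub>R s *\<^sub>R f = (r * s) *\<^sub>R f"
    by (simp add: scaleR_hardy_def)
  show "1 *\<^sub>R f = f"
    by (simp add: scaleR_hardy_def)
  show "sgn f = inverse (norm f) *\<^sub>R f"
    by (rule sgn_hardy_def)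
  show "dist f g = norm (f - g)"
    by (rule dist_hardy_def)
  show "(uniformity :: (hardy \<times> hardy) filter) = (INF e\<in>{0 <..}. principal {(x, y). dist x y < e})"
    by (rule uniformity_hardy_def)
  show "open U = (\<forall>x\<in>U. eventually (\<lambda>(x', y). x' = x \<longrightarrow> y \<in> U) uniformity)"
    by (rule open_hardy_def)
  show "inner f g = inner g f"
    by (simp add: inner_hardy_def hardy_inner_commute[of g f])
  show "inner (f + g) h = inner f h + inner g h"
    by (simp add: inner_hardy_def hardy_inner_add_left)
  show "inner (r *\<^sub>R f) g = r * inner f g"
    by (simp add: inner_hardy_def scaleR_hardy_def hardy_inner_cscale_left)
  have inner_self: "inner f f = (\<Sum>n. (norm (hardy_coeff f n))\<^sup>2)"
    by (simp add: inner_hardy_def hardy_inner_self)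
  show "0 \<le> inner f f"
    unfolding inner_self by (intro suminf_nonneg hardy_coeff_summable) auto
  show "inner f f = 0 \<longleftrightarrow> f = 0"
    unfolding inner_self hardy_eq_0_iff
    using suminf_eq_zero_iff[OF hardy_coeff_summable[of f]] by simp
  show "norm f = sqrt (inner f f)"
    by (simp add: inner_self norm_hardy_def)
qed

end

lift_definition hardy_poly :: "complex poly \<Rightarrow> hardy" is
  "\<lambda>p z. if z \<in> ball 0 1 then poly p z else 0"
proof -
  fix p :: "complex poly"
  define f where "f = (\<lambda>z. if z \<in> ball 0 1 then poly p z else 0)"
  have "poly p holomorphic_on ball 0 1"
    by (intro holomorphic_intros)
  hence "f holomorphic_on ball 0 1"
    by (rule holomorphic_transform) (simp add: f_def)
  moreover have "taylor_coeff f n = coeff p n" for n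
    unfolding taylor_coeff_poly [symmetric] by (rule taylor_coeff_cong) (simp add: f_def)
  moreover have "summable (\<lambda>n. (norm (coeff p n))\<^sup>2)"
    by (rule summable_finite[of "{..degree p}"]) (auto simp: coeff_eq_0)
  ultimately show "(\<lambda>z. if z \<in> ball 0 1 then poly p z else 0) \<in> hardy_set"
    unfolding f_def [symmetric] hardy_set_def by (auto simp: f_def)
qed

lift_definition mult_z :: "hardy \<Rightarrow> hardy" is "\<lambda>f z. z * f z"
proof -
  fix f assume f: "f \<in> hardy_set"
  have "summable (\<lambda>n. (norm (taylor_coeff (\<lambda>z. z * f z) (Suc n)))\<^sup>2)"
    using f by (simp add: hardy_set_def taylor_coeff_mult_z)
  hence "summable (\<lambda>n. (norm (taylor_coeff (\<lambda>z. z * f z) n))\<^sup>2)"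
    by (rule summable_Suc_iff [THEN iffD1])
  thus "(\<lambda>z. z * f z) \<in> hardy_set"
    using f by (auto simp: hardy_set_def intro!: holomorphic_intros)
qed

definition orth_proj :: "hardy set \<Rightarrow> hardy \<Rightarrow> hardy" where
  "orth_proj K f = (THE p. p \<in> K \<and> (\<forall>h\<in>K. hardy_inner (f - p) h = 0))"

definition orth_diff :: "hardy set \<Rightarrow> hardy set \<Rightarrow> hardy set"  (infixl "\<ominus>\<^sub>H" 65) where
  "M \<ominus>\<^sub>H N = {f \<in> M. \<forall>g\<in>N. hardy_inner f g = 0}"

definition is_orth_sum3 :: "hardy set \<Rightarrow> hardy set \<Rightarrow> hardy set \<Rightarrow> hardy set \<Rightarrow> bool" where
  "is_orth_sum3 M A B C \<longleftrightarrow>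
     (\<forall>a\<in>A. \<forall>b\<in>B. hardy_inner a b = 0) \<and>
     (\<forall>a\<in>A. \<forall>c\<in>C. hardy_inner a c = 0) \<and>
     (\<forall>b\<in>B. \<forall>c\<in>C. hardy_inner b c = 0) \<and>
     M = {a + b + c | a b c. a \<in> A \<and> b \<in> B \<and> c \<in> C}"

definition generated_by :: "(hardy \<Rightarrow> hardy) \<Rightarrow> hardy set \<Rightarrow> hardy set" where
  "generated_by T E = closure (hardy.span {(T ^^ n) h | n h. h \<in> E})"

definition H2ab :: "complex \<Rightarrow> complex \<Rightarrow> hardy set" where
  "H2ab \<alpha> \<beta> = closure (hardy.span ({hardy_poly [:\<alpha>, \<beta>:]} \<union> {hardy_poly (monom 1 n) | n. n \<ge> 2}))"

text \<open>The operator is only meaningful on \<open>H2ab \<alpha> \<beta>\<close>, which it maps into itself.\<close>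

definition S_op :: "complex \<Rightarrow> complex \<Rightarrow> hardy \<Rightarrow> hardy" where
  "S_op \<alpha> \<beta> f = orth_proj (H2ab \<alpha> \<beta>) (mult_z f)"

definition closed_invariant_subspace :: "complex \<Rightarrow> complex \<Rightarrow> hardy set \<Rightarrow> bool" where
  "closed_invariant_subspace \<alpha> \<beta> M \<longleftrightarrow>
     M \<subseteq> H2ab \<alpha> \<beta> \<and> hardy.subspace M \<and> closed M \<and> S_op \<alpha> \<beta> ` M \<subseteq> M"

definition inner_function :: "(complex \<Rightarrow> complex) \<Rightarrow> bool" where
  "inner_function \<theta> \<longleftrightarrow>
     \<theta> holomorphic_on ball 0 1 \<and> (\<forall>z\<in>ball 0 1. norm (\<theta> z) \<le> 1) \<and>
     (AE t in lborel. \<exists>l. norm l = 1 \<and> ((\<lambda>r. \<theta> (of_real r * cis t)) \<longlongrightarrow> l) (at_left 1))"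

definition mult_range :: "(complex \<Rightarrow> complex) \<Rightarrow> hardy set" where
  "mult_range \<phi> = {f. \<exists>h. \<forall>z\<in>ball 0 1. hardy_fun f z = \<phi> z * hardy_fun h z}"

definition has_associated_inner ::
    "complex \<Rightarrow> complex \<Rightarrow> hardy set \<Rightarrow> (complex \<Rightarrow> complex) \<Rightarrow> bool" where
  "has_associated_inner \<alpha> \<beta> M \<theta> \<longleftrightarrow>
     inner_function \<theta> \<and> \<theta> (\<alpha> * cnj \<beta>) \<noteq> 0 \<and>
     (\<exists>g f1 f2.
        g \<in> UNIV \<ominus>\<^sub>H mult_range \<theta> \<and>
        (\<forall>z\<in>ball 0 1. (z - \<alpha> * cnj \<beta>) * hardy_fun g z =
            \<beta> / \<theta> (\<alpha> * cnj \<beta>) * (\<theta> z - \<theta> (\<alpha> * cnj \<beta>))) \<and>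
        (\<forall>z\<in>ball 0 1. hardy_fun f1 z =
            \<alpha> * cnj \<beta> * (\<alpha> + \<beta> * z) + \<beta> * z ^ 2 + z ^ 3 * hardy_fun g z) \<and>
        (\<forall>z\<in>ball 0 1. hardy_fun f2 z =
            (\<alpha> + \<beta> * z) + z ^ 2 * hardy_fun g z
            - cnj \<alpha> * \<beta> / cnj \<beta> * cnj (\<theta> (\<alpha> * cnj \<beta>)) * of_real (1 + (norm g)\<^sup>2) * z ^ 2 * \<theta> z) \<and>
        is_orth_sum3 M (hardy.span {f2}) (hardy.span {f1}) (mult_range (\<lambda>z. z ^ 3 * \<theta> z)))"

definition cubic_root :: real where
  "cubic_root = (THE x. x ^ 3 + 7 * x ^ 2 + 12 * x - 1 = 0)"

lemma cubic_root_unique: "\<exists>!x::real. x ^ 3 + 7 * x ^ 2 + 12 * x - 1 = 0"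
proof -
  define p where "p = (\<lambda>x::real. x ^ 3 + 7 * x ^ 2 + 12 * x - 1)"
  have pos: "x > 0" if "p x = 0" for x
  proof (rule ccontr)
    assume "\<not> x > 0"
    define t where "t = -x"
    have t: "t \<ge> 0" "t * (t - 3) * (4 - t) = 1"
      using \<open>\<not> x > 0\<close> that by (auto simp: t_def p_def algebra_simps power2_eq_square power3_eq_cube)
    have "3 < t"
    proof (rule ccontr)
      assume *: "\<not> 3 < t"
      hence "t * (3 - t) * (4 - t) \<ge> 0"
        using t(1) by (intro mult_nonneg_nonneg) auto
      thus False using t(2) by (simp add: algebra_simps)
    qed
    moreover have "t < 4"
    proof (rule ccontr)
      assume *: "\<not> t < 4"
      hence "t * (t - 3) * (t - 4) \<ge> 0"
        by (intro mult_nonneg_nonneg) auto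
      thus False using t(2) by (simp add: algebra_simps)
    qed
    moreover have "(t - 3) * (4 - t) \<le> 1 / 4"
      using zero_le_power2[of "t - 7 / 2"] by (simp add: algebra_simps power2_eq_square)
    ultimately have "t * ((t - 3) * (4 - t)) \<le> t * (1 / 4)" "t < 4"
      using mult_left_mono[OF _ t(1)] by blast+
    thus False using t(2) unfolding mult.assoc by linarith
  qed
  have mono: "p x < p y" if "0 < x" "x < y" for x y
    using that power_strict_mono[of x y 3] power_strict_mono[of x y 2] by (simp add: p_def)
  have "\<exists>x\<ge>0. x \<le> 1 \<and> p x = 0"
    by (rule IVT) (auto simp: p_def)
  then obtain x where "p x = 0" by blast
  moreover have "y = x" if "p y = 0" for y
    using mono[of x y] mono[of y x] pos[OF that] pos[OF \<open>p x = 0\<close>] that \<open>p x = 0\<close>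
    by (cases x y rule: linorder_cases) auto
  ultimately show ?thesis
    unfolding p_def by blast
qed

end

theory Submission
  imports Defs
begin

text \<open>
  Write \<open>\<mu> = \<alpha> * cnj \<beta>\<close>. On the whole Hardy space the operator acts by
  \<open>S f = z f - f 0 * e\<close>, where \<open>e z = z - cnj \<beta> * (\<alpha> + \<beta> z) = \<bar>\<alpha>\<bar>\<^sup>2 z - \<mu>\<close> spans the orthogonal
  complement of \<open>H2ab \<alpha> \<beta>\<close>. Hence each point \<open>u\<close> of the disc yields a continuous eigenfunctional

    \<open>\<psi> u f = (u - \<mu>) * f u - f 0 * e u\<close>,   with   \<open>\<psi> u (S f) = u * \<psi> u f\<close>.

  If \<open>\<theta>\<close> is the Moebius factor vanishing at \<open>a\<close>, the subspace with associated inner function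
  \<open>\<theta>\<close> is the kernel of \<open>\<psi> a\<close> in \<open>H2ab \<alpha> \<beta>\<close>; in particular it is closed and invariant.
  To recognise the prescribed shape put \<open>p = f0 + z\<^sup>2 g\<close>, \<open>w = z\<^sup>2 \<theta>\<close> and \<open>\<tau> = \<theta> \<mu>\<close>. These two
  vectors are orthogonal, and the equation that determines \<open>g\<close> says
  \<open>f1 = S p = \<mu> p + (\<beta> / \<tau>) w\<close>, while \<open>f2 = p - \<kappa> w\<close>; the constant \<open>\<kappa>\<close> is the one that makes
  \<open>f2\<close> orthogonal to \<open>f1\<close>.

  The image \<open>S M\<close> contains \<open>f1 = S p\<close> and \<open>z\<^sup>3 \<theta> H\<^sup>2 = S (z\<^sup>2 \<theta> H\<^sup>2)\<close>, so the orthogonal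
  complement of \<open>S M\<close> in \<open>M\<close> is contained in the line through \<open>f2\<close> (\<open>wandering_subspace\<close>). Since
  \<open>\<psi> u p = (\<beta> / \<tau>) u\<^sup>2 \<theta> u\<close> and \<open>\<psi> u w = (u - \<mu>) u\<^sup>2 \<theta> u\<close>, the functional \<open>\<psi> c\<close> kills \<open>f2\<close> at the point
  \<open>c = \<mu> + \<beta> / (\<tau> \<kappa>)\<close>, provided that it lies in the disc. It then kills everything that \<open>f2\<close>
  generates but, as long as \<open>c \<noteq> a\<close>, not the element \<open>w\<close> of \<open>M\<close> (\<open>not_generated\<close>).

  It remains to choose \<open>a\<close> with \<open>\<bar>c\<bar> < \<bar>a\<bar>\<close>. Let \<open>a\<close> be real and tend to \<open>1\<close>. Then \<open>c\<close> tends to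
  \<open>(cnj \<beta> / cnj \<alpha>) * (2 - b)\<close> with \<open>b = \<bar>\<beta>\<bar>\<^sup>2\<close>, and the modulus of this limit is less than \<open>1\<close>
  exactly when \<open>b (2 - b)\<^sup>2 < 1 - b\<close>; the substitution \<open>b = 1 / (4 + x)\<close> turns this into
  \<open>x\<^sup>3 + 7 x\<^sup>2 + 12 x - 1 > 0\<close>, the condition on \<open>\<beta>\<close> (\<open>cubic_bound\<close>).
\<close>

section \<open>Hardy space elements and their Taylor coefficients\<close>

text \<open>
  With Taylor's formula \<open>hardy_fun_sums\<close> this identifies the Hardy space with the square-summable
  sequences, so that elements can be constructed and compared through their coefficients.
  The power series converges in the disc because the coefficients and the powers of a point of
  the disc are both square-summable.
\<close>

lemma hardy_of_coeffs:
  fixes s :: "nat \<Rightarrow> complex"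
  assumes "summable (\<lambda>n. (norm (s n))\<^sup>2)"
  obtains f where "\<And>n. hardy_coeff f n = s n"
proof -
  define F where "F = Abs_fps s"
  have "summable (\<lambda>n. s n * of_real r ^ n)" if r: "0 < r" "ereal r < 1" for r :: real
  proof -
    have "summable (\<lambda>n. (r\<^sup>2) ^ n)"
      using r by (intro summable_geometric) (simp add: power_less_one_iff)
    moreover have "(norm (of_real r ^ n :: complex))\<^sup>2 = (r\<^sup>2) ^ n" for n
      using r by (simp add: norm_power mult.commute flip: power_mult)
    ultimately have "summable (\<lambda>n. (norm (of_real r ^ n :: complex))\<^sup>2)"
      by simp
    from summable_mult_cnj[OF assms this] show ?thesis by simp
  qed
  hence radius: "fps_conv_radius F \<ge> 1"
    unfolding fps_conv_radius_def F_def fps_nth_Abs_fps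
    by (intro conv_radius_geI_ex) (metis abs_of_pos norm_of_real)
  have "(1 :: ereal) > 0" by simp
  with radius have pos: "fps_conv_radius F > 0" by (rule less_le_trans[rotated])
  define f where "f = (\<lambda>z. if z \<in> ball 0 1 then eval_fps F z else 0)"
  have "eval_fps F holomorphic_on ball 0 1"
  proof (rule holomorphic_on_eval_fps)
    show "ball 0 1 \<subseteq> eball 0 (fps_conv_radius F)"
      using radius by (intro ball_eball_mono) (simp add: one_ereal_def)
  qed
  hence hol: "f holomorphic_on ball 0 1"
    by (rule holomorphic_transform) (simp add: f_def)
  have coeff: "taylor_coeff f n = s n" for n
  proof -
    have "taylor_coeff f n = taylor_coeff (eval_fps F) n"
      by (rule taylor_coeff_cong) (simp add: f_def)
    also have "eval_fps F has_fps_expansion F"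
      using pos by (simp add: has_fps_expansion_def)
    hence "taylor_coeff (eval_fps F) n = s n"
      by (simp add: taylor_coeff_def fps_expansion_eqI F_def)
    finally show ?thesis .
  qed
  have "f \<in> hardy_set"
    using hol assms by (simp add: hardy_set_def coeff) (simp add: f_def)
  hence "hardy_coeff (Abs_hardy f) n = s n" for n
    by (simp add: Abs_hardy_inverse coeff)
  thus thesis by (rule that)
qed

lemma hardy_fun_sums:
  assumes "z \<in> ball 0 1"
  shows "(\<lambda>n. hardy_coeff f n * z ^ n) sums hardy_fun f z"
  using holomorphic_power_series[OF hardy_fun_holomorphic assms, of f]
  by (simp add: taylor_coeff_def fps_expansion_def)

lemma hardy_coeff_0: "hardy_coeff f 0 = hardy_fun f 0"
  by (simp add: taylor_coeff_def fps_expansion_def)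

lemma hardy_coeff_diff [simp]: "hardy_coeff (f - g) n = hardy_coeff f n - hardy_coeff g n"
proof -
  have "f - g = f + (-1) *\<^sub>C g"
    by (rule hardy_eqI) simp
  thus ?thesis by (simp only: hardy_coeff_add hardy_coeff_cscale) simp
qed

lemma hardy_coeff_eqI:
  assumes "\<And>n. hardy_coeff f n = hardy_coeff g n"
  shows "f = g"
  using hardy_eq_0_iff[of "f - g"] assms by simp

lemma hardy_coeff_poly [simp]: "hardy_coeff (hardy_poly p) n = coeff p n"
  unfolding taylor_coeff_poly [symmetric]
  by (rule taylor_coeff_cong) (simp add: hardy_poly.rep_eq)

lemma hardy_fun_poly: "z \<in> ball 0 1 \<Longrightarrow> hardy_fun (hardy_poly p) z = poly p z"
  by (simp add: hardy_poly.rep_eq)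

lemma hardy_fun_mult_z [simp]: "hardy_fun (mult_z f) z = z * hardy_fun f z"
  by (simp add: mult_z.rep_eq)

lemma hardy_coeff_mult_z:
  "hardy_coeff (mult_z f) n = (case n of 0 \<Rightarrow> 0 | Suc m \<Rightarrow> hardy_coeff f m)"
  by (simp add: mult_z.rep_eq taylor_coeff_mult_z[OF hardy_fun_holomorphic])

lemma mult_z_surj:
  assumes "hardy_coeff f 0 = 0"
  obtains h where "f = mult_z h"
proof -
  have "summable (\<lambda>n. (norm (hardy_coeff f (Suc n)))\<^sup>2)"
    using hardy_coeff_summable[of f] by (subst summable_Suc_iff)
  then obtain h where h: "\<And>n. hardy_coeff h n = hardy_coeff f (Suc n)"
    by (rule hardy_of_coeffs) blast
  have "f = mult_z h"
    by (rule hardy_coeff_eqI) (simp add: hardy_coeff_mult_z h assms split: nat.split)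
  thus thesis by (rule that)
qed

section \<open>The inner product and the reproducing kernel\<close>

lemma hardy_inner_add_right: "hardy_inner f (g + h) = hardy_inner f g + hardy_inner f h"
  by (metis complex_cnj_add hardy_inner_add_left hardy_inner_commute)

lemma hardy_inner_cscale_right: "hardy_inner f (c *\<^sub>C g) = cnj c * hardy_inner f g"
  by (metis complex_cnj_mult hardy_inner_cscale_left hardy_inner_commute)

lemma hardy_inner_diff_left: "hardy_inner (f - g) h = hardy_inner f h - hardy_inner g h"
  using hardy_inner_add_left[of "f - g" g h] by simp

lemma hardy_inner_diff_right: "hardy_inner f (g - h) = hardy_inner f g - hardy_inner f h"
  using hardy_inner_add_right[of f "g - h" h] by simp

lemmas hardy_inner_linear =
  hardy_inner_add_left hardy_inner_add_right hardy_inner_diff_left hardy_inner_diff_right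
  hardy_inner_cscale_left hardy_inner_cscale_right

lemma hardy_inner_self_norm: "hardy_inner f f = of_real ((norm f)\<^sup>2)"
proof -
  have "(\<Sum>n. (norm (hardy_coeff f n))\<^sup>2) \<ge> 0"
    by (intro suminf_nonneg hardy_coeff_summable) auto
  thus ?thesis by (simp add: hardy_inner_self norm_hardy_def)
qed

lemma hardy_inner_self_eq_0_iff [simp]: "hardy_inner f f = 0 \<longleftrightarrow> f = 0"
  by (simp add: hardy_inner_self_norm)

lemma hardy_inner_orth_sym: "hardy_inner f g = 0 \<Longrightarrow> hardy_inner g f = 0"
  by (metis complex_cnj_zero hardy_inner_commute)

lemma hardy_inner_mult_z: "hardy_inner (mult_z f) (mult_z g) = hardy_inner f g"
  using suminf_split_head[OF hardy_inner_summable, of "mult_z f" "mult_z g"]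
  by (simp add: hardy_inner_def hardy_coeff_mult_z)

lemma hardy_inner_poly:
  assumes "degree p \<le> n"
  shows "hardy_inner f (hardy_poly p) = (\<Sum>k\<le>n. hardy_coeff f k * cnj (coeff p k))"
  unfolding hardy_inner_def hardy_coeff_poly
  by (rule suminf_finite) (use assms in \<open>auto simp: coeff_eq_0\<close>)

lemma continuous_on_hardy_inner [continuous_intros]:
  "continuous_on A (\<lambda>f. hardy_inner f g)"
proof -
  have "hardy_inner f g = of_real (inner f g) + \<i> * of_real (inner f (\<i> *\<^sub>C g))" for f
    by (simp add: inner_hardy_def hardy_inner_cscale_right complex_eq_iff)
  thus ?thesis by (simp add: continuous_intros)
qed

lemma continuous_on_hardy_coeff [continuous_intros]:
  "continuous_on A (\<lambda>f. hardy_coeff f n)"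
proof -
  have "hardy_coeff f n = hardy_inner f (hardy_poly (monom 1 n))" for f
    by (subst hardy_inner_poly[of _ n]) (auto simp: degree_monom_le coeff_monom if_distrib cong: if_cong)
  thus ?thesis by (simp add: continuous_intros)
qed

text \<open>
  The Szego kernel at \<open>a\<close> has the powers of \<open>cnj a\<close> as Taylor coefficients, so that pairing with
  it sums the Taylor series at \<open>a\<close>. Evaluation at a point of the disc is therefore continuous.
\<close>

lemma szego_kernel:
  assumes "norm a < 1"
  obtains k where
    "\<And>z. z \<in> ball 0 1 \<Longrightarrow> hardy_fun k z = 1 / (1 - cnj a * z)"
    "\<And>f. hardy_inner f k = hardy_fun f a"
proof -
  have "summable (\<lambda>n. ((norm a)\<^sup>2) ^ n)"
    using assms by (intro summable_geometric) (simp add: power_less_one_iff)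
  hence "summable (\<lambda>n. (norm (cnj a ^ n))\<^sup>2)"
    by (simp add: norm_power flip: power_mult) (simp add: mult.commute)
  then obtain k where k: "\<And>n. hardy_coeff k n = cnj a ^ n"
    by (rule hardy_of_coeffs) blast
  have "hardy_fun k z = 1 / (1 - cnj a * z)" if z: "z \<in> ball 0 1" for z
  proof -
    have "norm (cnj a * z) < 1"
      using assms z mult_strict_mono'[of "norm a" 1 "norm z" 1] by (simp add: norm_mult)
    hence "(\<lambda>n. (cnj a * z) ^ n) sums (1 / (1 - cnj a * z))"
      by (rule geometric_sums)
    moreover have "(\<lambda>n. (cnj a * z) ^ n) sums hardy_fun k z"
      using hardy_fun_sums[OF z, of k] by (simp add: k power_mult_distrib)
    ultimately show ?thesis by (rule sums_unique2[symmetric])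
  qed
  moreover have "hardy_inner f k = hardy_fun f a" for f
    using hardy_fun_sums[of a f] assms unfolding hardy_inner_def
    by (simp add: k sums_iff)
  ultimately show thesis by (rule that)
qed

lemma continuous_on_hardy_fun [continuous_intros]:
  "continuous_on A (\<lambda>f. hardy_fun f z)"
proof (cases "norm z < 1")
  case True
  then obtain k where "\<And>f. hardy_inner f k = hardy_fun f z"
    using szego_kernel by blast
  thus ?thesis
    using continuous_on_hardy_inner[of A k] by simp
qed (simp add: hardy_fun_outside)

section \<open>Dividing out a zero\<close>

text \<open>
  A zero can be divided out within the Hardy space: the quotient \<open>h\<close> has to satisfy
  \<open>h n = f (n + 1) + a * h (n + 1)\<close> on coefficients, which is solved by the tails \<open>m\<close> of the
  series of \<open>f\<close> at \<open>a\<close>, shifted by one place. The zero enters as \<open>m 0 = 0\<close>. The tails are bounded,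
  and the recurrence improves this to square-summability.
\<close>

lemma divide_zero:
  assumes a: "norm a < 1" and zero: "hardy_fun f a = 0"
  obtains h where "f = mult_z h - a *\<^sub>C h"
proof -
  define \<rho> where "\<rho> = norm a"
  have \<rho>: "0 \<le> \<rho>" "\<rho> < 1" using a by (auto simp: \<rho>_def)
  define c where "c = hardy_coeff f"
  have c2: "summable (\<lambda>n. (norm (c n))\<^sup>2)"
    unfolding c_def by (rule hardy_coeff_summable)
  have "summable (\<lambda>n. c n * a ^ n)"
    using hardy_fun_sums[of a f] a by (auto simp: c_def sums_iff)
  have "(\<lambda>n. (norm (c n))\<^sup>2) \<longlonglongrightarrow> 0"
    using c2 by (rule summable_LIMSEQ_zero)
  hence "Bseq (\<lambda>n. (norm (c n))\<^sup>2)"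
    by (intro convergent_imp_Bseq convergentI)
  then obtain B where B: "\<And>n. (norm (c n))\<^sup>2 \<le> B"
    unfolding Bseq_def by auto
  define C where "C = max B 1"
  have C: "norm (c n) \<le> C" for n
  proof (cases "norm (c n) \<le> 1")
    case False
    hence "norm (c n) \<le> (norm (c n))\<^sup>2"
      by (simp add: power2_eq_square mult_le_cancel_left1)
    thus ?thesis using B[of n] by (simp add: C_def)
  qed (simp add: C_def)
  have dom: "norm (c (n + j) * a ^ j) \<le> C * \<rho> ^ j" for n j
    using C[of "n + j"] \<rho> by (simp add: norm_mult norm_power \<rho>_def mult_right_mono)
  have geom: "summable (\<lambda>j. C * \<rho> ^ j)"
    using \<rho> by (intro summable_mult summable_geometric) simp
  have summ: "summable (\<lambda>j. c (n + j) * a ^ j)" for n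
    by (rule summable_comparison_test'[OF geom]) (rule dom)
  define m where "m = (\<lambda>n. \<Sum>j. c (n + j) * a ^ j)"
  have m_rec: "m n = c n + a * m (Suc n)" for n
  proof -
    have "m n = c n + (\<Sum>j. c (n + Suc j) * a ^ Suc j)"
      unfolding m_def using suminf_split_head[OF summ[of n]] by simp
    also have "(\<lambda>j. c (n + Suc j) * a ^ Suc j) = (\<lambda>j. a * (c (Suc n + j) * a ^ j))"
      by (simp add: fun_eq_iff mult_ac)
    finally show ?thesis
      unfolding m_def using suminf_mult[OF summ[of "Suc n"]] by simp
  qed
  have m_0: "m 0 = 0"
    using zero hardy_fun_sums[of a f] a by (simp add: m_def c_def sums_iff)
  define D where "D = (\<Sum>j. C * \<rho> ^ j)"
  have D: "norm (m n) \<le> D" for n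
    unfolding m_def D_def
    by (rule norm_suminf_le[OF dom geom])
  \<comment> \<open>Convexity of the square turns the recurrence into an estimate that loses a factor \<open>\<rho> < 1\<close>.\<close>
  have sq: "(norm (m n))\<^sup>2 \<le> (norm (c n))\<^sup>2 / (1 - \<rho>) + \<rho> * (norm (m (Suc n)))\<^sup>2" for n
  proof -
    define x y where "x = norm (c n)" and "y = norm (m (Suc n))"
    have "norm (m n) \<le> x + \<rho> * y"
      unfolding x_def y_def \<rho>_def by (subst m_rec) (metis norm_mult norm_triangle_ineq)
    hence "(norm (m n))\<^sup>2 \<le> (x + \<rho> * y)\<^sup>2"
      by (intro power_mono) auto
    also have "x\<^sup>2 / (1 - \<rho>) + \<rho> * y\<^sup>2 - (x + \<rho> * y)\<^sup>2 = \<rho> / (1 - \<rho>) * (x - (1 - \<rho>) * y)\<^sup>2"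
      using \<rho> by (simp add: field_simps power2_eq_square)
    hence "(x + \<rho> * y)\<^sup>2 \<le> x\<^sup>2 / (1 - \<rho>) + \<rho> * y\<^sup>2"
      using \<rho> by (smt (verit) divide_nonneg_pos mult_nonneg_nonneg zero_le_power2)
    finally show ?thesis unfolding x_def y_def .
  qed
  define K where "K = (\<Sum>n. (norm (c n))\<^sup>2)"
  \<comment> \<open>Summed up, the estimate bounds a partial sum \<open>A\<close> by \<open>\<rho> * A\<close> and a constant, the boundary
    term at \<open>N\<close> being controlled by \<open>D\<close>.\<close>
  have "summable (\<lambda>n. (norm (m n))\<^sup>2)"
  proof (rule summableI_nonneg_bounded)
    fix N
    define A where "A = (\<Sum>n<N. (norm (m n))\<^sup>2)"
    have "A \<le> (\<Sum>n<N. (norm (c n))\<^sup>2 / (1 - \<rho>) + \<rho> * (norm (m (Suc n)))\<^sup>2)"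
      unfolding A_def by (intro sum_mono sq)
    also have "\<dots> = (\<Sum>n<N. (norm (c n))\<^sup>2) / (1 - \<rho>) + \<rho> * (\<Sum>n<N. (norm (m (Suc n)))\<^sup>2)"
      by (simp add: sum.distrib sum_divide_distrib sum_distrib_left)
    also have "(\<Sum>n<N. (norm (c n))\<^sup>2) / (1 - \<rho>) \<le> K / (1 - \<rho>)"
      unfolding K_def using \<rho> by (intro divide_right_mono sum_le_suminf c2) auto
    also have "(\<Sum>n<N. (norm (m (Suc n)))\<^sup>2) = A + (norm (m N))\<^sup>2"
      using sum.lessThan_Suc_shift[of "\<lambda>n. (norm (m n))\<^sup>2" N] by (simp add: A_def m_0)
    also have "(norm (m N))\<^sup>2 \<le> D\<^sup>2"
      using D[of N] by (intro power_mono) auto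
    finally have "A \<le> K / (1 - \<rho>) + \<rho> * (A + D\<^sup>2)"
      using \<rho> by (simp add: mult_left_mono)
    hence "A * (1 - \<rho>) \<le> K / (1 - \<rho>) + \<rho> * D\<^sup>2"
      by (simp add: algebra_simps)
    thus "A \<le> (K / (1 - \<rho>) + \<rho> * D\<^sup>2) / (1 - \<rho>)"
      using \<rho> by (simp add: pos_le_divide_eq)
  qed auto
  hence "summable (\<lambda>n. (norm (m (Suc n)))\<^sup>2)"
    by (subst summable_Suc_iff)
  then obtain h where h: "\<And>n. hardy_coeff h n = m (Suc n)"
    by (rule hardy_of_coeffs) blast
  have "f = mult_z h - a *\<^sub>C h"
  proof (rule hardy_coeff_eqI)
    fix n
    show "hardy_coeff f n = hardy_coeff (mult_z h - a *\<^sub>C h) n"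
      using m_rec[of n] m_0
      by (cases n) (simp_all add: hardy_coeff_mult_z h c_def eq_neg_iff_add_eq_0)
  qed
  thus thesis by (rule that)
qed

lemma closure_span_induct:
  assumes "\<And>f g. P f \<Longrightarrow> P g \<Longrightarrow> P (f + g)" "\<And>c f. P f \<Longrightarrow> P (c *\<^sub>C f)" "P 0"
    and "closed {f. P f}" and "\<And>f. f \<in> E \<Longrightarrow> P f"
  shows "f \<in> closure (hardy.span E) \<Longrightarrow> P f"
proof -
  have "hardy.subspace {f. P f}"
    using assms(1-3) by (auto simp: hardy.subspace_def)
  hence "hardy.span E \<subseteq> {f. P f}"
    using assms(5) by (intro hardy.span_minimal) auto
  hence "closure (hardy.span E) \<subseteq> {f. P f}"
    using assms(4) by (rule closure_minimal)
  thus "f \<in> closure (hardy.span E) \<Longrightarrow> P f" by auto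
qed

section \<open>The space and its operator\<close>

text \<open>
  The two lowest coefficients of an element form a multiple of \<open>(\<alpha>, \<beta>)\<close>, and this is the only
  restriction. The condition passes to closures because coefficients are continuous; conversely,
  Taylor sections of an \<open>f\<close> that satisfies it lie in the span and converge to \<open>f\<close>.
\<close>

lemma H2ab_eq:
  assumes "\<alpha> \<noteq> 0"
  shows "H2ab \<alpha> \<beta> = {f. \<beta> * hardy_coeff f 0 = \<alpha> * hardy_coeff f 1}"
proof (intro equalityI subsetI CollectI)
  fix f assume "f \<in> H2ab \<alpha> \<beta>"
  thus "\<beta> * hardy_coeff f 0 = \<alpha> * hardy_coeff f 1"
    unfolding H2ab_def
    by (rule closure_span_induct[rotated -1])
      (auto simp: algebra_simps simp del: hardy_fun_simps intro!: closed_Collect_eq continuous_intros)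
next
  fix f assume "f \<in> {f. \<beta> * hardy_coeff f 0 = \<alpha> * hardy_coeff f 1}"
  hence f: "\<beta> * hardy_coeff f 0 = \<alpha> * hardy_coeff f 1" by simp
  define E where "E = {hardy_poly [:\<alpha>, \<beta>:]} \<union> {hardy_poly (monom 1 n) | n. n \<ge> 2}"
  define q where "q = (\<lambda>N. (hardy_coeff f 0 / \<alpha>) *\<^sub>C hardy_poly [:\<alpha>, \<beta>:] +
    (\<Sum>n\<in>{2..<N}. hardy_coeff f n *\<^sub>C hardy_poly (monom 1 n)))"
  have q_span: "q N \<in> hardy.span E" for N
    unfolding q_def E_def
    by (intro hardy.span_add hardy.span_scale hardy.span_sum hardy.span_base) auto
  have sum_coeff: "hardy_coeff (\<Sum>n\<in>A. h n) m = (\<Sum>n\<in>A. hardy_coeff (h n) m)"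
    if "finite A" for A :: "nat set" and h m
    using that by induction (simp_all del: hardy_fun_simps)
  have q_coeff: "hardy_coeff (f - q N) m = (if m < N then 0 else hardy_coeff f m)" if "N \<ge> 2" for N m
  proof -
    have "(\<Sum>n\<in>{2..<N}. hardy_coeff f n * coeff (monom 1 n) m) =
        (if 2 \<le> m \<and> m < N then hardy_coeff f m else 0)"
      by (simp add: coeff_monom if_distrib cong: if_cong)
    moreover have "hardy_coeff f 0 / \<alpha> * coeff [:\<alpha>, \<beta>:] m = (if m < 2 then hardy_coeff f m else 0)"
      using f assms
      by (cases m; cases "m - 1") (auto simp: field_simps numeral_2_eq_2)
    ultimately show ?thesis
      using that by (auto simp: q_def sum_coeff simp del: hardy_fun_simps hardy_fun_diff)
  qed
  have "(\<lambda>N. q (N + 2)) \<longlonglongrightarrow> f"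
  proof -
    let ?s = "\<lambda>n. (norm (hardy_coeff f n))\<^sup>2"
    have norm_eq: "(norm (q N - f))\<^sup>2 = (\<Sum>n. ?s (n + N))" if "N \<ge> 2" for N
    proof -
      have "(norm (f - q N))\<^sup>2 = (\<Sum>n. (norm (hardy_coeff (f - q N) n))\<^sup>2)"
        unfolding norm_hardy_def
        by (intro real_sqrt_pow2 suminf_nonneg hardy_coeff_summable) auto
      also have "\<dots> = (\<Sum>n. (norm (hardy_coeff (f - q N) (n + N)))\<^sup>2) +
          (\<Sum>n<N. (norm (hardy_coeff (f - q N) n))\<^sup>2)"
        by (rule suminf_split_initial_segment[OF hardy_coeff_summable])
      finally show ?thesis
        using that by (simp add: q_coeff norm_minus_commute del: hardy_coeff_diff)
    qed
    have "(\<lambda>N. \<Sum>n. ?s (n + N)) \<longlonglongrightarrow> 0"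
      by (rule suminf_exist_split2[OF hardy_coeff_summable])
    hence "(\<lambda>N. \<Sum>n. ?s (n + (N + 2))) \<longlonglongrightarrow> 0"
      by (rule LIMSEQ_ignore_initial_segment)
    hence "(\<lambda>N. (norm (q (N + 2) - f))\<^sup>2) \<longlonglongrightarrow> 0"
      by (simp add: norm_eq)
    hence "(\<lambda>N. sqrt ((norm (q (N + 2) - f))\<^sup>2)) \<longlonglongrightarrow> sqrt 0"
      by (rule tendsto_real_sqrt)
    hence "(\<lambda>N. norm (q (N + 2) - f)) \<longlonglongrightarrow> 0" by simp
    thus ?thesis by (rule LIM_zero_cancel[OF tendsto_norm_zero_cancel])
  qed
  thus "f \<in> H2ab \<alpha> \<beta>"
    unfolding H2ab_def E_def[symmetric] closure_sequential
    using q_span by (intro exI[of _ "\<lambda>N. q (N + 2)"]) simp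
qed

text \<open>For \<open>\<alpha> \<noteq> 0\<close> it spans the orthogonal complement of \<open>H2ab \<alpha> \<beta>\<close>.\<close>

definition normal_vector :: "complex \<Rightarrow> complex \<Rightarrow> hardy" where
  "normal_vector \<alpha> \<beta> = hardy_poly [:- (\<alpha> * cnj \<beta>), \<alpha> * cnj \<alpha>:]"

lemma orth_normal_vector:
  assumes "\<alpha> \<noteq> 0" "f \<in> H2ab \<alpha> \<beta>"
  shows "hardy_inner f (normal_vector \<alpha> \<beta>) = 0"
proof -
  have "hardy_inner f (normal_vector \<alpha> \<beta>) =
      cnj \<alpha> * (\<alpha> * hardy_coeff f 1 - \<beta> * hardy_coeff f 0)"
    unfolding normal_vector_def
    by (subst hardy_inner_poly[of _ 1]) (auto simp: algebra_simps)
  thus ?thesis using assms by (simp add: H2ab_eq)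
qed

lemma orth_proj_eqI:
  assumes K: "hardy.subspace K" and p: "p \<in> K" "\<And>h. h \<in> K \<Longrightarrow> hardy_inner (f - p) h = 0"
  shows "orth_proj K f = p"
  unfolding orth_proj_def
proof (rule the_equality)
  fix q assume q: "q \<in> K \<and> (\<forall>h\<in>K. hardy_inner (f - q) h = 0)"
  have "p - q \<in> K"
    using K p(1) q hardy.subspace_diff by blast
  hence "hardy_inner (f - q) (p - q) - hardy_inner (f - p) (p - q) = 0"
    using p q by simp
  hence "hardy_inner (p - q) (p - q) = 0"
    by (simp flip: hardy_inner_diff_left)
  thus "q = p" by simp
qed (use p in auto)

lemma subspace_H2ab: "\<alpha> \<noteq> 0 \<Longrightarrow> hardy.subspace (H2ab \<alpha> \<beta>)"
  by (auto simp: H2ab_eq hardy.subspace_def algebra_simps)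

locale unit_pair =
  fixes \<alpha> \<beta> :: complex
  assumes \<alpha>_nz: "\<alpha> \<noteq> 0" and \<beta>_nz: "\<beta> \<noteq> 0"
    and unit: "(norm \<alpha>)\<^sup>2 + (norm \<beta>)\<^sup>2 = 1"
begin

definition \<mu> :: complex where "\<mu> = \<alpha> * cnj \<beta>"

lemma unit': "\<alpha> * cnj \<alpha> + \<beta> * cnj \<beta> = 1"
  using unit by (metis complex_norm_square of_real_1 of_real_add)

text \<open>
  Since \<open>z - cnj \<beta> * (\<alpha> + \<beta> z)\<close> is the normal vector, the compression to \<open>H2ab \<alpha> \<beta>\<close> only
  corrects \<open>z f\<close> by a multiple of it, and the constant term of \<open>f\<close> gives the multiple.
\<close>

lemma S_op_mem: "S_op \<alpha> \<beta> f \<in> H2ab \<alpha> \<beta>"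
  and S_op_eq: "S_op \<alpha> \<beta> f = mult_z f - hardy_coeff f 0 *\<^sub>C normal_vector \<alpha> \<beta>"
proof -
  define p where "p = mult_z f - hardy_coeff f 0 *\<^sub>C normal_vector \<alpha> \<beta>"
  have "hardy_coeff p 0 = hardy_coeff f 0 * (\<alpha> * cnj \<beta>)"
    by (simp add: p_def hardy_coeff_mult_z normal_vector_def)
  moreover have "hardy_coeff p 1 = hardy_coeff f 0 * (1 - \<alpha> * cnj \<alpha>)"
    by (simp add: p_def hardy_coeff_mult_z normal_vector_def algebra_simps)
  moreover have "1 - \<alpha> * cnj \<alpha> = \<beta> * cnj \<beta>"
    using unit' by (simp add: algebra_simps)
  ultimately have p: "p \<in> H2ab \<alpha> \<beta>"
    using \<alpha>_nz by (simp add: H2ab_eq)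
  have "S_op \<alpha> \<beta> f = p"
    unfolding S_op_def
  proof (rule orth_proj_eqI[OF subspace_H2ab[OF \<alpha>_nz] p])
    fix h assume "h \<in> H2ab \<alpha> \<beta>"
    hence "hardy_inner (normal_vector \<alpha> \<beta>) h = 0"
      using orth_normal_vector[OF \<alpha>_nz] hardy_inner_orth_sym by blast
    moreover have "mult_z f - p = hardy_coeff f 0 *\<^sub>C normal_vector \<alpha> \<beta>"
      by (simp add: p_def)
    ultimately show "hardy_inner (mult_z f - p) h = 0"
      by (simp add: hardy_inner_cscale_left)
  qed
  with p show "S_op \<alpha> \<beta> f \<in> H2ab \<alpha> \<beta>"
    and "S_op \<alpha> \<beta> f = mult_z f - hardy_coeff f 0 *\<^sub>C normal_vector \<alpha> \<beta>"
    by (auto simp: p_def)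
qed

lemma hardy_fun_S_op:
  assumes "z \<in> ball 0 1"
  shows "hardy_fun (S_op \<alpha> \<beta> f) z = z * hardy_fun f z - hardy_fun f 0 * (\<alpha> * cnj \<alpha> * z - \<mu>)"
  using assms by (simp add: S_op_eq normal_vector_def hardy_fun_poly hardy_coeff_0 \<mu>_def algebra_simps)

lemma S_op_add: "S_op \<alpha> \<beta> (f + h) = S_op \<alpha> \<beta> f + S_op \<alpha> \<beta> h"
proof (rule hardy_eqI)
  fix z :: complex assume z: "z \<in> ball 0 1"
  show "hardy_fun (S_op \<alpha> \<beta> (f + h)) z = hardy_fun (S_op \<alpha> \<beta> f + S_op \<alpha> \<beta> h) z"
    unfolding hardy_fun_simps hardy_fun_S_op[OF z] by (simp add: algebra_simps)
qed

lemma S_op_cscale: "S_op \<alpha> \<beta> (c *\<^sub>C f) = c *\<^sub>C S_op \<alpha> \<beta> f"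
proof (rule hardy_eqI)
  fix z :: complex assume z: "z \<in> ball 0 1"
  show "hardy_fun (S_op \<alpha> \<beta> (c *\<^sub>C f)) z = hardy_fun (c *\<^sub>C S_op \<alpha> \<beta> f) z"
    unfolding hardy_fun_simps hardy_fun_S_op[OF z] by (simp add: algebra_simps)
qed

lemma S_op_eq_mult_z: "hardy_fun f 0 = 0 \<Longrightarrow> S_op \<alpha> \<beta> f = mult_z f"
  by (rule hardy_eqI) (simp add: hardy_fun_S_op)

definition eigenfunctional :: "complex \<Rightarrow> hardy \<Rightarrow> complex" where
  "eigenfunctional w f = (w - \<mu>) * hardy_fun f w - hardy_fun f 0 * (\<alpha> * cnj \<alpha> * w - \<mu>)"

text \<open>
  Evaluating \<open>S f = z f - f 0 * e\<close> at \<open>w\<close> and at \<open>0\<close> shows that the span of the two evaluations is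
  invariant under the transpose of \<open>S\<close>, with the triangular action \<open>f 0 \<mapsto> \<mu> * f 0\<close> and
  \<open>f w \<mapsto> w * f w - f 0 * e w\<close>; the functional is the eigenvector with eigenvalue \<open>w\<close>.
\<close>

lemma eigenfunctional_S_op:
  assumes "norm w < 1"
  shows "eigenfunctional w (S_op \<alpha> \<beta> f) = w * eigenfunctional w f"
proof -
  have "hardy_fun (S_op \<alpha> \<beta> f) 0 = \<mu> * hardy_fun f 0"
    by (simp add: hardy_fun_S_op)
  thus ?thesis
    using assms by (simp add: eigenfunctional_def hardy_fun_S_op algebra_simps)
qed

lemma eigenfunctional_linear [simp]:
  "eigenfunctional w 0 = 0"
  "eigenfunctional w (f + g) = eigenfunctional w f + eigenfunctional w g"
  "eigenfunctional w (f - g) = eigenfunctional w f - eigenfunctional w g"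
  "eigenfunctional w (c *\<^sub>C f) = c * eigenfunctional w f"
  by (simp_all add: eigenfunctional_def algebra_simps)

lemma closed_eigenfunctional_kernel: "closed {f. eigenfunctional w f = 0}"
  unfolding eigenfunctional_def by (intro closed_Collect_eq continuous_intros)

lemma generated_by_eigenfunctional:
  assumes "norm w < 1" "\<And>f. f \<in> E \<Longrightarrow> eigenfunctional w f = 0"
    and "f \<in> generated_by (S_op \<alpha> \<beta>) E"
  shows "eigenfunctional w f = 0"
proof (rule closure_span_induct[where P = "\<lambda>f. eigenfunctional w f = 0"])
  show "f \<in> closure (hardy.span {(S_op \<alpha> \<beta> ^^ n) h |n h. h \<in> E})"
    using assms(3) by (simp add: generated_by_def)
  have "eigenfunctional w ((S_op \<alpha> \<beta> ^^ n) h) = w ^ n * eigenfunctional w h" for n h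
    by (induction n) (simp_all add: eigenfunctional_S_op[OF assms(1)])
  thus "eigenfunctional w f = 0" if "f \<in> {(S_op \<alpha> \<beta> ^^ n) h |n h. h \<in> E}" for f
    using that assms(2) by auto
qed (simp_all add: closed_eigenfunctional_kernel)

lemma norm_\<mu>: "norm \<mu> < 1"
proof -
  have "norm \<mu> = norm \<alpha> * norm \<beta>" by (simp add: \<mu>_def norm_mult)
  moreover have "2 * (norm \<alpha> * norm \<beta>) \<le> (norm \<alpha>)\<^sup>2 + (norm \<beta>)\<^sup>2"
    using zero_le_power2[of "norm \<alpha> - norm \<beta>"] by (simp add: power2_diff)
  ultimately show ?thesis using unit by simp
qed

end


section \<open>The invariant subspace of a Moebius factor\<close>

locale moebius_factor = unit_pair +
  fixes a :: complex
  assumes a_nz: "a \<noteq> 0" and a_disc: "norm a < 1" and a_neq: "a \<noteq> \<alpha> * cnj \<beta>"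
begin

definition \<theta> :: "complex \<Rightarrow> complex" where "\<theta> z = (z - a) / (1 - cnj a * z)"

definition \<tau> :: complex where "\<tau> = \<theta> \<mu>"

definition szego :: hardy where
  "szego = (SOME k. (\<forall>z\<in>ball 0 1. hardy_fun k z = 1 / (1 - cnj a * z)) \<and>
                    (\<forall>f. hardy_inner f k = hardy_fun f a))"

lemma szego: "z \<in> ball 0 1 \<Longrightarrow> hardy_fun szego z = 1 / (1 - cnj a * z)"
  and hardy_inner_szego: "hardy_inner f szego = hardy_fun f a"
proof -
  have "\<exists>k. (\<forall>z\<in>ball 0 1. hardy_fun k z = 1 / (1 - cnj a * z)) \<and>
            (\<forall>f. hardy_inner f k = hardy_fun f a)"
    using szego_kernel[OF a_disc] by metis
  from someI_ex[OF this]
  show "z \<in> ball 0 1 \<Longrightarrow> hardy_fun szego z = 1 / (1 - cnj a * z)"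
    and "hardy_inner f szego = hardy_fun f a"
    unfolding szego_def by auto
qed

lemma denominator_nz:
  assumes "norm z \<le> 1"
  shows "1 - cnj a * z \<noteq> 0"
proof
  assume "1 - cnj a * z = 0"
  hence "norm (cnj a * z) = 1" by simp
  moreover have "norm (cnj a * z) \<le> norm a * 1"
    unfolding norm_mult using assms by (intro mult_mono) auto
  ultimately show False using a_disc by simp
qed

lemma \<theta>_nz: "norm z < 1 \<Longrightarrow> z \<noteq> a \<Longrightarrow> \<theta> z \<noteq> 0"
  using denominator_nz[of z] by (simp add: \<theta>_def)

lemma \<tau>_nz: "\<tau> \<noteq> 0"
  unfolding \<tau>_def by (rule \<theta>_nz[OF norm_\<mu>]) (use a_neq in \<open>simp add: \<mu>_def\<close>)

text \<open>
  This identity makes the Moebius factor bounded by \<open>1\<close> in the disc and unimodular on the circle.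
\<close>

lemma norm_\<theta>_identity:
  "(norm (1 - cnj a * z))\<^sup>2 - (norm (z - a))\<^sup>2 = (1 - (norm a)\<^sup>2) * (1 - (norm z)\<^sup>2)"
proof -
  have "complex_of_real ((norm (1 - cnj a * z))\<^sup>2 - (norm (z - a))\<^sup>2) =
      of_real ((1 - (norm a)\<^sup>2) * (1 - (norm z)\<^sup>2))"
    by (simp add: complex_norm_square algebra_simps del: of_real_power)
  thus ?thesis by (simp only: of_real_eq_iff)
qed

lemma inner_function_\<theta>: "inner_function \<theta>"
  unfolding inner_function_def
proof (intro conjI ballI AE_I2)
  have "\<theta> holomorphic_on cball 0 1"
    unfolding \<theta>_def using denominator_nz by (intro holomorphic_intros) auto
  thus hol: "\<theta> holomorphic_on ball 0 1"
    by (rule holomorphic_on_subset) auto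
  have a2: "0 \<le> 1 - (norm a)\<^sup>2"
    using a_disc by (simp add: power_le_one)
  show "norm (\<theta> z) \<le> 1" if "z \<in> ball 0 1" for z
  proof -
    have "(norm z)\<^sup>2 \<le> 1" using that by (simp add: power_le_one)
    hence "0 \<le> (1 - (norm a)\<^sup>2) * (1 - (norm z)\<^sup>2)"
      using a2 by (intro mult_nonneg_nonneg) auto
    hence "(norm (z - a))\<^sup>2 \<le> (norm (1 - cnj a * z))\<^sup>2"
      unfolding norm_\<theta>_identity[symmetric] by linarith
    hence "norm (z - a) \<le> norm (1 - cnj a * z)"
      by (rule power2_le_imp_le) simp
    thus ?thesis
      using denominator_nz[of z] that by (simp add: \<theta>_def norm_divide)
  qed
  fix t :: real
  have "isCont \<theta> (of_real 1 * cis t)"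
    unfolding \<theta>_def[abs_def] using denominator_nz[of "cis t"] by (intro continuous_intros) simp
  moreover have "isCont (\<lambda>r::real. of_real r * cis t) 1"
    by (intro continuous_intros)
  ultimately have "isCont (\<lambda>r::real. \<theta> (of_real r * cis t)) 1"
    by (rule isCont_o2[rotated])
  hence "((\<lambda>r::real. \<theta> (of_real r * cis t)) \<longlongrightarrow> \<theta> (of_real 1 * cis t)) (at_left 1)"
    unfolding isCont_def by (rule filterlim_mono) (auto simp: at_le)
  moreover have "norm (\<theta> (cis t)) = 1"
  proof -
    have "(norm (cis t - a))\<^sup>2 = (norm (1 - cnj a * cis t))\<^sup>2"
      using norm_\<theta>_identity[of "cis t"] by simp
    hence "norm (cis t - a) = norm (1 - cnj a * cis t)" by simp
    thus ?thesis
      using denominator_nz[of "cis t"] by (simp add: \<theta>_def norm_divide)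
  qed
  ultimately show "\<exists>l. norm l = 1 \<and> ((\<lambda>r. \<theta> (of_real r * cis t)) \<longlongrightarrow> l) (at_left 1)"
    by auto
qed

text \<open>
  The Moebius factor as an element of the Hardy space. Its partial fraction form makes inner
  products with it computable from values at \<open>0\<close> and at \<open>a\<close>.
\<close>

definition \<Theta> :: hardy where
  "\<Theta> = (- 1 / cnj a) *\<^sub>C hardy_poly [:1:] + ((1 - a * cnj a) / cnj a) *\<^sub>C szego"

text \<open>
  The difference quotient of a Moebius factor is a multiple of the Szego kernel; this is \<open>\<beta> / \<tau>\<close>
  times the difference quotient of \<open>\<theta>\<close> at \<open>\<mu>\<close>.
\<close>

definition g :: hardy where
  "g = (\<beta> / \<tau> * ((1 - a * cnj a) / (1 - cnj a * \<mu>))) *\<^sub>C szego"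

definition \<kappa> :: complex where
  "\<kappa> = cnj \<alpha> * \<beta> / cnj \<beta> * cnj \<tau> * of_real (1 + (norm g)\<^sup>2)"

definition p :: hardy where "p = hardy_poly [:\<alpha>, \<beta>:] + mult_z (mult_z g)"

definition w :: hardy where "w = mult_z (mult_z \<Theta>)"

definition f1 :: hardy where "f1 = \<mu> *\<^sub>C p + (\<beta> / \<tau>) *\<^sub>C w"

definition f2 :: hardy where "f2 = p - \<kappa> *\<^sub>C w"

definition M :: "hardy set" where "M = {f \<in> H2ab \<alpha> \<beta>. eigenfunctional a f = 0}"

definition N :: "hardy set" where "N = mult_range (\<lambda>z. z ^ 3 * \<theta> z)"

lemma hardy_fun_\<Theta>: "z \<in> ball 0 1 \<Longrightarrow> hardy_fun \<Theta> z = \<theta> z"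
  using denominator_nz[of z] a_nz
  by (simp add: \<Theta>_def \<theta>_def szego hardy_fun_poly field_simps)

lemma hardy_fun_g:
  assumes "z \<in> ball 0 1"
  shows "(z - \<mu>) * hardy_fun g z = \<beta> / \<tau> * (\<theta> z - \<tau>)"
proof -
  have nz: "1 - cnj a * z \<noteq> 0" "1 - cnj a * \<mu> \<noteq> 0"
    using denominator_nz[of z] denominator_nz[of \<mu>] assms norm_\<mu> by auto
  have "\<theta> z - \<tau> = (z - \<mu>) * ((1 - a * cnj a) / (1 - cnj a * \<mu>)) / (1 - cnj a * z)"
    unfolding \<tau>_def \<theta>_def using nz by (simp add: divide_simps) (simp add: algebra_simps)
  thus ?thesis
    using assms by (simp add: g_def szego mult_ac)
qed

lemma hardy_fun_p: "z \<in> ball 0 1 \<Longrightarrow> hardy_fun p z = \<alpha> + \<beta> * z + z ^ 2 * hardy_fun g z"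
  by (simp add: p_def hardy_fun_poly power2_eq_square algebra_simps)

lemma hardy_fun_w: "z \<in> ball 0 1 \<Longrightarrow> hardy_fun w z = z ^ 2 * \<theta> z"
  by (simp add: w_def hardy_fun_\<Theta> power2_eq_square)

lemma hardy_fun_f2:
  "z \<in> ball 0 1 \<Longrightarrow> hardy_fun f2 z = (\<alpha> + \<beta> * z) + z ^ 2 * hardy_fun g z - \<kappa> * z ^ 2 * \<theta> z"
  by (simp add: f2_def hardy_fun_p hardy_fun_w)

lemma hardy_fun_f1:
  assumes "z \<in> ball 0 1"
  shows "hardy_fun f1 z = \<mu> * (\<alpha> + \<beta> * z) + \<beta> * z ^ 2 + z ^ 3 * hardy_fun g z"
proof -
  have "\<beta> / \<tau> * \<theta> z = (z - \<mu>) * hardy_fun g z + \<beta>"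
    using hardy_fun_g[OF assms] \<tau>_nz by (simp add: algebra_simps)
  moreover have "hardy_fun f1 z =
      \<mu> * (\<alpha> + \<beta> * z + z ^ 2 * hardy_fun g z) + z ^ 2 * (\<beta> / \<tau> * \<theta> z)"
    using assms by (simp add: f1_def hardy_fun_p hardy_fun_w)
  ultimately have "hardy_fun f1 z = \<mu> * (\<alpha> + \<beta> * z + z ^ 2 * hardy_fun g z) +
      z ^ 2 * ((z - \<mu>) * hardy_fun g z + \<beta>)"
    by (simp only:)
  thus ?thesis by (simp add: algebra_simps power2_eq_square power3_eq_cube)
qed

text \<open>
  By the equation for \<open>g\<close>, applying \<open>S\<close> to \<open>p\<close> yields exactly \<open>f1\<close>.
\<close>

lemma S_op_p: "S_op \<alpha> \<beta> p = f1"
proof (rule hardy_eqI)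
  fix z :: complex assume z: "z \<in> ball 0 1"
  have p0: "hardy_fun p 0 = \<alpha>" by (simp add: hardy_fun_p)
  have "z * (\<alpha> + \<beta> * z + z ^ 2 * hardy_fun g z) - \<alpha> * (\<alpha> * cnj \<alpha> * z - \<mu>) -
      (\<mu> * (\<alpha> + \<beta> * z) + \<beta> * z ^ 2 + z ^ 3 * hardy_fun g z) =
      \<alpha> * z * (1 - (\<alpha> * cnj \<alpha> + \<beta> * cnj \<beta>))"
    by (simp add: \<mu>_def algebra_simps power2_eq_square power3_eq_cube)
  hence eq: "z * (\<alpha> + \<beta> * z + z ^ 2 * hardy_fun g z) - \<alpha> * (\<alpha> * cnj \<alpha> * z - \<mu>) =
      \<mu> * (\<alpha> + \<beta> * z) + \<beta> * z ^ 2 + z ^ 3 * hardy_fun g z"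
    by (simp only: unit' diff_self mult_zero_right right_minus_eq)
  show "hardy_fun (S_op \<alpha> \<beta> p) z = hardy_fun f1 z"
    unfolding hardy_fun_S_op[OF z] hardy_fun_f1[OF z] hardy_fun_p[OF z] p0 by (rule eq)
qed

text \<open>
  As \<open>\<theta>\<close> has the single zero \<open>a \<noteq> 0\<close>, the range of multiplication by \<open>z\<^sup>3 \<theta>\<close> is cut out by
  vanishing conditions at \<open>0\<close> and at \<open>a\<close>: the zeros can be divided out, and multiplying by the
  denominator \<open>1 - cnj a * z\<close> stays in the Hardy space.
\<close>

lemma N_eq: "N = {f. (\<forall>j<3. hardy_coeff f j = 0) \<and> hardy_fun f a = 0}"
proof (intro equalityI subsetI CollectI)
  fix f assume "f \<in> N"
  then obtain h where h: "\<And>z. z \<in> ball 0 1 \<Longrightarrow> hardy_fun f z = z ^ 3 * \<theta> z * hardy_fun h z"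
    unfolding N_def mult_range_def by blast
  have "hardy_coeff f j = 0" if "j < 3" for j
  proof -
    have "\<theta> holomorphic_on ball 0 1"
      using inner_function_\<theta> by (simp add: inner_function_def)
    hence hol: "(\<lambda>z. \<theta> z * hardy_fun h z) holomorphic_on ball 0 1"
      by (intro holomorphic_intros hardy_fun_holomorphic)
    hence hol1: "(\<lambda>z. z * (\<theta> z * hardy_fun h z)) holomorphic_on ball 0 1"
      by (rule holomorphic_on_mult[OF holomorphic_on_ident])
    hence hol2: "(\<lambda>z. z * (z * (\<theta> z * hardy_fun h z))) holomorphic_on ball 0 1"
      by (rule holomorphic_on_mult[OF holomorphic_on_ident])
    have "hardy_coeff f j = taylor_coeff (\<lambda>z. z * (z * (z * (\<theta> z * hardy_fun h z)))) j"
      by (rule taylor_coeff_cong) (simp add: h power3_eq_cube)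
    also have "\<dots> = 0"
      using that
      by (simp add: taylor_coeff_mult_z[OF hol2] taylor_coeff_mult_z[OF hol1]
          taylor_coeff_mult_z[OF hol] split: nat.split)
    finally show ?thesis .
  qed
  moreover have "hardy_fun f a = 0"
    using a_disc by (simp add: h \<theta>_def)
  ultimately show "(\<forall>j<3. hardy_coeff f j = 0) \<and> hardy_fun f a = 0" by blast
next
  fix f assume "f \<in> {f. (\<forall>j<3. hardy_coeff f j = 0) \<and> hardy_fun f a = 0}"
  hence f: "hardy_coeff f 0 = 0" "hardy_coeff f 1 = 0" "hardy_coeff f 2 = 0" "hardy_fun f a = 0"
    by auto
  from f(1) obtain f' where f': "f = mult_z f'" by (rule mult_z_surj)
  from f(2) have "hardy_coeff f' 0 = 0" by (simp add: f' hardy_coeff_mult_z)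
  then obtain f'' where f'': "f' = mult_z f''" by (rule mult_z_surj)
  from f(3) have "hardy_coeff f'' 0 = 0"
    by (simp add: f' f'' hardy_coeff_mult_z numeral_2_eq_2)
  then obtain q where q: "f'' = mult_z q" by (rule mult_z_surj)
  have "hardy_fun q a = 0"
    using f(4) a_nz by (simp add: f' f'' q)
  then obtain h where h: "q = mult_z h - a *\<^sub>C h"
    using divide_zero[OF a_disc] by blast
  have "hardy_fun f z = z ^ 3 * \<theta> z * hardy_fun (h - cnj a *\<^sub>C mult_z h) z"
    if "z \<in> ball 0 1" for z
  proof -
    have "\<theta> z * hardy_fun (h - cnj a *\<^sub>C mult_z h) z = \<theta> z * (1 - cnj a * z) * hardy_fun h z"
      by (simp add: algebra_simps)
    also have "\<theta> z * (1 - cnj a * z) = z - a"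
      using denominator_nz[of z] that by (simp add: \<theta>_def)
    also have "(z - a) * hardy_fun h z = hardy_fun q z"
      by (simp add: h algebra_simps)
    finally show ?thesis
      by (simp add: f' f'' q power3_eq_cube mult.assoc)
  qed
  thus "f \<in> N" unfolding N_def mult_range_def by blast
qed

lemma N_D:
  assumes "f \<in> N"
  shows "hardy_coeff f 0 = 0" "hardy_coeff f 1 = 0" "hardy_coeff f 2 = 0"
    "hardy_fun f 0 = 0" "hardy_fun f a = 0"
  using assms by (auto simp: N_eq simp flip: hardy_coeff_0)

lemma p_coeff: "hardy_coeff p 0 = \<alpha>" "hardy_coeff p 1 = \<beta>" "hardy_fun p 0 = \<alpha>"
  by (simp_all add: p_def hardy_coeff_mult_z hardy_fun_poly del: hardy_fun_simps)
    (simp add: hardy_fun_poly)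

lemma w_coeff: "hardy_coeff w 0 = 0" "hardy_coeff w 1 = 0" "hardy_coeff w 2 = - a" "hardy_fun w 0 = 0"
  "hardy_fun w a = 0"
  by (simp_all add: w_def hardy_coeff_mult_z numeral_2_eq_2 hardy_coeff_0 hardy_fun_\<Theta> a_disc \<theta>_def)

text \<open>
  After removal of the common factor \<open>z\<^sup>2\<close> everything reduces to pairings of \<open>\<Theta>\<close> with constants
  and with the Szego kernel, which are the values \<open>\<theta> 0 = - a\<close> and \<open>\<theta> a = 0\<close>.
\<close>

lemma hardy_inner_p_p: "hardy_inner p p = of_real (1 + (norm g)\<^sup>2)"
  and hardy_inner_p_w: "hardy_inner p w = 0"
  and hardy_inner_w_w: "hardy_inner w w = 1"
proof -
  have f0: "hardy_inner (mult_z (mult_z h)) (hardy_poly [:\<alpha>, \<beta>:]) = 0" for h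
    by (subst hardy_inner_poly[of _ 1]) (auto simp: hardy_coeff_mult_z)
  hence f0': "hardy_inner (hardy_poly [:\<alpha>, \<beta>:]) (mult_z (mult_z h)) = 0" for h
    by (rule hardy_inner_orth_sym)
  have "hardy_inner (hardy_poly [:\<alpha>, \<beta>:]) (hardy_poly [:\<alpha>, \<beta>:]) = \<alpha> * cnj \<alpha> + \<beta> * cnj \<beta>"
    by (subst hardy_inner_poly[of _ 1]) auto
  hence "hardy_inner p p = 1 + hardy_inner g g"
    by (simp add: p_def hardy_inner_linear f0 f0' hardy_inner_mult_z unit')
  thus "hardy_inner p p = of_real (1 + (norm g)\<^sup>2)"
    by (simp add: hardy_inner_self_norm)
  have \<Theta>: "hardy_inner \<Theta> szego = 0" "hardy_fun \<Theta> 0 = - a"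
    using a_disc by (simp_all add: hardy_inner_szego hardy_fun_\<Theta> \<theta>_def)
  from \<Theta>(1) have "hardy_inner szego \<Theta> = 0"
    by (rule hardy_inner_orth_sym)
  thus "hardy_inner p w = 0"
    by (simp add: p_def w_def hardy_inner_linear f0' hardy_inner_mult_z g_def)
  have "hardy_inner \<Theta> (hardy_poly [:1:]) = - a"
    by (subst hardy_inner_poly[of _ 0]) (simp_all add: hardy_coeff_0 \<Theta>)
  hence "hardy_inner \<Theta> \<Theta> = 1"
    using a_nz \<Theta>(1) by (subst \<Theta>_def(1)) (simp add: hardy_inner_linear)
  thus "hardy_inner w w = 1"
    by (simp add: w_def hardy_inner_mult_z)
qed

lemma hardy_inner_N:
  assumes "f \<in> N"
  shows "hardy_inner f p = 0" "hardy_inner f w = 0"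
proof -
  note f = N_D[OF assms]
  from f(1) obtain f' where f': "f = mult_z f'" by (rule mult_z_surj)
  from f(2) have "hardy_coeff f' 0 = 0" by (simp add: f' hardy_coeff_mult_z)
  then obtain h where h: "f' = mult_z h" by (rule mult_z_surj)
  from f(3) have h0: "hardy_coeff h 0 = 0"
    by (simp add: f' h hardy_coeff_mult_z numeral_2_eq_2)
  from f(5) have ha: "hardy_fun h a = 0"
    using a_nz by (simp add: f' h)
  have "hardy_inner f (hardy_poly [:\<alpha>, \<beta>:]) = 0"
    using f by (subst hardy_inner_poly[of _ 1]) auto
  thus "hardy_inner f p = 0"
    by (simp add: f' h p_def g_def hardy_inner_linear hardy_inner_mult_z hardy_inner_szego ha)
  have "hardy_inner h (hardy_poly [:1:]) = 0"
    using h0 by (subst hardy_inner_poly[of _ 0]) simp_all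
  thus "hardy_inner f w = 0"
    by (simp add: f' h w_def \<Theta>_def hardy_inner_linear hardy_inner_mult_z hardy_inner_szego ha)
qed

lemma hardy_inner_f2_f1: "hardy_inner f2 f1 = 0"
proof -
  have "hardy_inner w p = 0"
    using hardy_inner_p_w by (rule hardy_inner_orth_sym)
  hence "hardy_inner f2 f1 = cnj \<mu> * of_real (1 + (norm g)\<^sup>2) - \<kappa> * cnj (\<beta> / \<tau>)"
    by (simp add: f1_def f2_def hardy_inner_linear hardy_inner_p_p hardy_inner_p_w hardy_inner_w_w)
  also have "\<kappa> * cnj (\<beta> / \<tau>) = cnj \<mu> * of_real (1 + (norm g)\<^sup>2)"
    using \<tau>_nz \<beta>_nz by (simp add: \<kappa>_def \<mu>_def)
  finally show ?thesis by simp
qed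

lemma hardy_inner_f1_f2_N:
  assumes "f \<in> N"
  shows "hardy_inner f1 f = 0" "hardy_inner f2 f = 0"
  by (rule hardy_inner_orth_sym, simp add: f1_def f2_def hardy_inner_linear hardy_inner_N[OF assms])+

text \<open>
  The point \<open>c\<close> is where the eigenfunctional annihilates \<open>f2\<close>; see \<open>\<kappa>_c\<close>. The positive
  number \<open>\<delta>\<close> isolates how \<open>c\<close> depends on \<open>a\<close>.
\<close>

definition \<delta> :: real where "\<delta> = (norm \<tau>)\<^sup>2 * (1 + (norm g)\<^sup>2)"

definition c :: complex where "c = \<mu> + cnj \<beta> / (cnj \<alpha> * of_real \<delta>)"

lemma one_plus_norm_g: "0 < 1 + (norm g)\<^sup>2"
  by (rule add_pos_nonneg) auto

lemma \<delta>_pos: "\<delta> > 0"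
  using \<tau>_nz one_plus_norm_g by (simp add: \<delta>_def)

lemma \<kappa>_nz: "\<kappa> \<noteq> 0"
  using \<alpha>_nz \<beta>_nz \<tau>_nz one_plus_norm_g unfolding \<kappa>_def of_real_eq_0_iff mult_eq_0_iff by auto

lemma \<kappa>_c: "\<kappa> * (c - \<mu>) = \<beta> / \<tau>"
proof -
  define s where "s = complex_of_real (1 + (norm g)\<^sup>2)"
  have s: "s \<noteq> 0" using one_plus_norm_g unfolding s_def of_real_eq_0_iff by simp
  have "of_real \<delta> = \<tau> * cnj \<tau> * s"
    unfolding \<delta>_def s_def by (simp only: of_real_mult complex_norm_square)
  thus ?thesis
    unfolding \<kappa>_def s_def[symmetric] using s \<alpha>_nz \<beta>_nz \<tau>_nz by (simp add: c_def)
qed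

lemma c_neq_\<mu>: "c \<noteq> \<mu>"
  using \<alpha>_nz \<beta>_nz \<delta>_pos by (simp add: c_def)

text \<open>
  Up to the factor \<open>cnj \<beta> / cnj \<alpha>\<close>, the point \<open>c\<close> is a positive number.
\<close>

lemma c_nz: "c \<noteq> 0"
proof -
  have "c = cnj \<beta> / cnj \<alpha> * of_real ((norm \<alpha>)\<^sup>2 + 1 / \<delta>)"
    using \<alpha>_nz \<delta>_pos
    by (simp add: c_def \<mu>_def complex_norm_square field_simps del: of_real_power)
  moreover have "(norm \<alpha>)\<^sup>2 + 1 / \<delta> > 0"
    using \<delta>_pos by (intro add_nonneg_pos) auto
  hence "complex_of_real ((norm \<alpha>)\<^sup>2 + 1 / \<delta>) \<noteq> 0"
    unfolding of_real_eq_0_iff by simp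
  ultimately show ?thesis
    using \<alpha>_nz \<beta>_nz by (simp del: of_real_add)
qed

lemma eigenfunctional_p:
  assumes "z \<in> ball 0 1"
  shows "eigenfunctional z p = \<beta> / \<tau> * z ^ 2 * \<theta> z"
proof -
  have "eigenfunctional z p =
      (z - \<mu>) * (\<alpha> + \<beta> * z) + z ^ 2 * ((z - \<mu>) * hardy_fun g z) - \<alpha> * (\<alpha> * cnj \<alpha> * z - \<mu>)"
    using assms by (simp add: eigenfunctional_def p_coeff hardy_fun_p algebra_simps)
  also have "z ^ 2 * ((z - \<mu>) * hardy_fun g z) = \<beta> / \<tau> * z ^ 2 * \<theta> z - \<beta> * z ^ 2"
    unfolding hardy_fun_g[OF assms] using \<tau>_nz by (simp add: algebra_simps)
  also have "(z - \<mu>) * (\<alpha> + \<beta> * z) + (\<beta> / \<tau> * z ^ 2 * \<theta> z - \<beta> * z ^ 2) -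
      \<alpha> * (\<alpha> * cnj \<alpha> * z - \<mu>) =
      \<alpha> * z * (1 - (\<alpha> * cnj \<alpha> + \<beta> * cnj \<beta>)) + \<beta> / \<tau> * z ^ 2 * \<theta> z"
    by (simp add: \<mu>_def algebra_simps power2_eq_square)
  finally show ?thesis by (simp add: unit')
qed

lemma eigenfunctional_w:
  "z \<in> ball 0 1 \<Longrightarrow> eigenfunctional z w = (z - \<mu>) * z ^ 2 * \<theta> z"
  by (simp add: eigenfunctional_def w_coeff hardy_fun_w)

lemma p_in_M: "p \<in> M" and w_in_M: "w \<in> M"
  using \<alpha>_nz a_disc
  by (simp_all add: M_def H2ab_eq p_coeff[simplified] w_coeff[simplified]
      eigenfunctional_p eigenfunctional_w \<theta>_def)

lemma subspace_M: "hardy.subspace M"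
  using subspace_H2ab[OF \<alpha>_nz] by (auto simp: M_def hardy.subspace_def)

lemma M_I:
  assumes "hardy_coeff f 0 = 0" "hardy_coeff f 1 = 0" "hardy_fun f a = 0"
  shows "f \<in> M"
  using assms \<alpha>_nz by (simp add: M_def H2ab_eq eigenfunctional_def flip: hardy_coeff_0)

lemma closed_M: "closed M"
proof -
  have "M = H2ab \<alpha> \<beta> \<inter> {f. eigenfunctional a f = 0}" by (auto simp: M_def)
  moreover have "closed (H2ab \<alpha> \<beta>)" by (simp add: H2ab_def)
  ultimately show ?thesis using closed_eigenfunctional_kernel by auto
qed

lemma invariant_M: "closed_invariant_subspace \<alpha> \<beta> M"
  unfolding closed_invariant_subspace_def
  using subspace_M closed_M a_disc by (auto simp: M_def S_op_mem eigenfunctional_S_op)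

lemma M_combination:
  assumes "f \<in> N"
  shows "x *\<^sub>C f2 + y *\<^sub>C f1 + f \<in> M"
proof -
  have "f \<in> M" using N_D[OF assms] by (intro M_I)
  moreover have "f1 \<in> M" "f2 \<in> M"
    unfolding f1_def f2_def
    by (intro hardy.subspace_add hardy.subspace_diff hardy.subspace_scale subspace_M p_in_M w_in_M)+
  ultimately show ?thesis
    by (intro hardy.subspace_add hardy.subspace_scale subspace_M)
qed

text \<open>
  Subtracting suitable multiples of \<open>p\<close> and \<open>w\<close> clears the coefficients at \<open>0\<close>, \<open>1\<close> and \<open>2\<close>, and the
  remainder vanishes at \<open>a\<close> because \<open>M\<close> is the kernel of the eigenfunctional at \<open>a\<close>. Passing
  from \<open>p\<close>, \<open>w\<close> to \<open>f1\<close>, \<open>f2\<close> is a change of basis with determinant \<open>\<kappa> * c \<noteq> 0\<close>.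
\<close>

lemma M_decomposition:
  assumes "f \<in> M"
  obtains x y h where "h \<in> N" "f = x *\<^sub>C f2 + y *\<^sub>C f1 + h"
proof -
  define d where "d = hardy_coeff f 0 / \<alpha>"
  define q where "q = f - d *\<^sub>C p"
  have q0: "hardy_coeff q 0 = 0" and q1: "hardy_coeff q 1 = 0"
    using assms \<alpha>_nz by (simp_all add: q_def d_def p_coeff[simplified] M_def H2ab_eq field_simps)
  have "q \<in> M"
    unfolding q_def by (intro hardy.subspace_diff hardy.subspace_scale subspace_M p_in_M assms)
  hence qa: "hardy_fun q a = 0"
    using a_neq q0 by (simp add: M_def eigenfunctional_def \<mu>_def hardy_coeff_0)
  define e where "e = - hardy_coeff q 2 / a"
  define h where "h = q - e *\<^sub>C w"
  have "hardy_coeff h j = 0" if "j < 3" for j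
  proof -
    have "j = 0 \<or> j = 1 \<or> j = 2" using that by auto
    thus ?thesis
      unfolding h_def e_def using a_nz
      by (elim disjE; simp only: hardy_coeff_diff hardy_coeff_cscale q0 q1 w_coeff; simp)
  qed
  moreover have "hardy_fun h a = 0"
    by (simp add: h_def qa w_coeff)
  ultimately have h: "h \<in> N"
    by (auto simp: N_eq)
  define y where "y = (e + \<kappa> * d) / (\<kappa> * c)"
  define x where "x = d - \<mu> * y"
  have \<kappa>c: "\<kappa> * c = \<beta> / \<tau> + \<kappa> * \<mu>"
    using \<kappa>_c by (simp add: algebra_simps)
  have "y * (\<beta> / \<tau> + \<kappa> * \<mu>) = e + \<kappa> * d"
    unfolding \<kappa>c[symmetric] using \<kappa>_nz c_nz by (simp add: y_def)
  hence e: "e = y * (\<beta> / \<tau>) - \<kappa> * x"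
    by (simp add: x_def algebra_simps)
  have d: "d = x + \<mu> * y" by (simp add: x_def)
  have "f = d *\<^sub>C p + e *\<^sub>C w + h"
    by (rule hardy_eqI) (simp add: h_def q_def)
  also have "\<dots> = x *\<^sub>C f2 + y *\<^sub>C f1 + h"
    unfolding d e by (rule hardy_eqI) (simp add: f1_def f2_def algebra_simps)
  finally show thesis using h that by blast
qed

lemma g_orth: "g \<in> UNIV \<ominus>\<^sub>H mult_range \<theta>"
proof -
  have "hardy_inner g f = 0" if "f \<in> mult_range \<theta>" for f
  proof (rule hardy_inner_orth_sym)
    have "hardy_fun f a = 0"
      using that a_disc by (auto simp: mult_range_def \<theta>_def)
    thus "hardy_inner f g = 0"
      by (simp add: g_def hardy_inner_linear hardy_inner_szego)
  qed
  thus ?thesis by (simp add: orth_diff_def)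
qed

lemma M_orth_sum: "is_orth_sum3 M (hardy.span {f2}) (hardy.span {f1}) N"
  unfolding is_orth_sum3_def hardy.span_singleton
proof (intro conjI)
  show "M = {u + v + h |u v h. u \<in> range (\<lambda>k. k *\<^sub>C f2) \<and> v \<in> range (\<lambda>k. k *\<^sub>C f1) \<and> h \<in> N}"
  proof (intro equalityI subsetI)
    fix f assume "f \<in> M"
    then obtain x y h where "h \<in> N" "f = x *\<^sub>C f2 + y *\<^sub>C f1 + h" by (rule M_decomposition)
    thus "f \<in> {u + v + h |u v h. u \<in> range (\<lambda>k. k *\<^sub>C f2) \<and> v \<in> range (\<lambda>k. k *\<^sub>C f1) \<and> h \<in> N}"
      by blast
  qed (use M_combination in auto)
qed (auto simp: hardy_inner_linear hardy_inner_f2_f1 hardy_inner_f1_f2_N)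

lemma associated_inner: "has_associated_inner \<alpha> \<beta> M \<theta>"
  unfolding has_associated_inner_def
proof (intro conjI)
  show "inner_function \<theta>" by (rule inner_function_\<theta>)
  show "\<theta> (\<alpha> * cnj \<beta>) \<noteq> 0" using \<tau>_nz by (simp add: \<tau>_def \<mu>_def)
  show "\<exists>g f1 f2. g \<in> UNIV \<ominus>\<^sub>H mult_range \<theta> \<and>
      (\<forall>z\<in>ball 0 1. (z - \<alpha> * cnj \<beta>) * hardy_fun g z =
          \<beta> / \<theta> (\<alpha> * cnj \<beta>) * (\<theta> z - \<theta> (\<alpha> * cnj \<beta>))) \<and>
      (\<forall>z\<in>ball 0 1. hardy_fun f1 z =
          \<alpha> * cnj \<beta> * (\<alpha> + \<beta> * z) + \<beta> * z ^ 2 + z ^ 3 * hardy_fun g z) \<and>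
      (\<forall>z\<in>ball 0 1. hardy_fun f2 z =
          (\<alpha> + \<beta> * z) + z ^ 2 * hardy_fun g z
          - cnj \<alpha> * \<beta> / cnj \<beta> * cnj (\<theta> (\<alpha> * cnj \<beta>)) * of_real (1 + (norm g)\<^sup>2) * z ^ 2 * \<theta> z) \<and>
      is_orth_sum3 M (hardy.span {f2}) (hardy.span {f1}) (mult_range (\<lambda>z. z ^ 3 * \<theta> z))"
  proof (rule exI[of _ g], rule exI[of _ f1], rule exI[of _ f2], intro conjI)
    show "g \<in> UNIV \<ominus>\<^sub>H mult_range \<theta>" by (rule g_orth)
    show "\<forall>z\<in>ball 0 1. (z - \<alpha> * cnj \<beta>) * hardy_fun g z =
        \<beta> / \<theta> (\<alpha> * cnj \<beta>) * (\<theta> z - \<theta> (\<alpha> * cnj \<beta>))"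
      using hardy_fun_g by (simp add: \<tau>_def \<mu>_def)
    show "\<forall>z\<in>ball 0 1. hardy_fun f1 z =
        \<alpha> * cnj \<beta> * (\<alpha> + \<beta> * z) + \<beta> * z ^ 2 + z ^ 3 * hardy_fun g z"
      using hardy_fun_f1 by (simp add: \<mu>_def)
    show "\<forall>z\<in>ball 0 1. hardy_fun f2 z = (\<alpha> + \<beta> * z) + z ^ 2 * hardy_fun g z
        - cnj \<alpha> * \<beta> / cnj \<beta> * cnj (\<theta> (\<alpha> * cnj \<beta>)) * of_real (1 + (norm g)\<^sup>2) * z ^ 2 * \<theta> z"
      using hardy_fun_f2 by (simp add: \<kappa>_def \<tau>_def \<mu>_def)
    show "is_orth_sum3 M (hardy.span {f2}) (hardy.span {f1}) (mult_range (\<lambda>z. z ^ 3 * \<theta> z))"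
      using M_orth_sum by (simp add: N_def)
  qed
qed

text \<open>
  The part \<open>r\<close> of \<open>f\<close> along \<open>f1\<close> and \<open>z\<^sup>3 \<theta> H\<^sup>2\<close> is itself an image under \<open>S\<close>, and it is
  orthogonal to \<open>f2\<close>. If \<open>f\<close> is orthogonal to all images, then \<open>r\<close> is orthogonal to itself.
\<close>

lemma wandering_subspace:
  assumes "f \<in> M \<ominus>\<^sub>H (S_op \<alpha> \<beta> ` M)"
  obtains x where "f = x *\<^sub>C f2"
proof -
  from assms have "f \<in> M" by (simp add: orth_diff_def)
  then obtain x y h where h: "h \<in> N" and f: "f = x *\<^sub>C f2 + y *\<^sub>C f1 + h"
    by (rule M_decomposition)
  define r where "r = y *\<^sub>C f1 + h"
  from N_D(1)[OF h] obtain h' where h': "h = mult_z h'" by (rule mult_z_surj)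
  have h'0: "hardy_coeff h' 0 = 0" "hardy_coeff h' 1 = 0" "hardy_fun h' a = 0"
    using N_D[OF h] a_nz by (simp_all add: h' hardy_coeff_mult_z numeral_2_eq_2)
  have "S_op \<alpha> \<beta> (y *\<^sub>C p + h') = r"
    using h'0 by (simp add: r_def S_op_add S_op_cscale S_op_p S_op_eq_mult_z h' flip: hardy_coeff_0)
  moreover have "y *\<^sub>C p + h' \<in> M"
    by (intro hardy.subspace_add hardy.subspace_scale subspace_M p_in_M M_I h'0)
  ultimately have "r \<in> S_op \<alpha> \<beta> ` M" by blast
  hence "hardy_inner f r = 0"
    using assms unfolding orth_diff_def by blast
  moreover have "hardy_inner f2 r = 0"
    by (simp add: r_def hardy_inner_linear hardy_inner_f2_f1 hardy_inner_f1_f2_N[OF h])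
  moreover have f_eq: "f = x *\<^sub>C f2 + r"
    by (simp add: f r_def add.assoc)
  ultimately have "hardy_inner r r = 0"
    by (simp add: hardy_inner_linear)
  hence "f = x *\<^sub>C f2" by (simp add: f_eq)
  thus thesis by (rule that)
qed

text \<open>
  The hypothesis on \<open>c\<close> serves twice: it puts \<open>c\<close> into the disc, where the eigenfunctional is
  available, and it keeps \<open>c\<close> away from the zero \<open>a\<close> of \<open>\<theta>\<close>, so that \<open>w\<close> is not annihilated.
\<close>

lemma not_generated:
  assumes "norm c < norm a"
  shows "M \<noteq> generated_by (S_op \<alpha> \<beta>) (M \<ominus>\<^sub>H (S_op \<alpha> \<beta> ` M))"
proof
  assume eq: "M = generated_by (S_op \<alpha> \<beta>) (M \<ominus>\<^sub>H (S_op \<alpha> \<beta> ` M))"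
  have c: "c \<in> ball 0 1" using assms a_disc by simp
  have "eigenfunctional c f2 = c ^ 2 * \<theta> c * (\<beta> / \<tau> - \<kappa> * (c - \<mu>))"
    using c by (simp add: f2_def eigenfunctional_p eigenfunctional_w algebra_simps)
  hence f2: "eigenfunctional c f2 = 0" by (simp add: \<kappa>_c)
  have vanish: "eigenfunctional c f = 0" if "f \<in> M \<ominus>\<^sub>H (S_op \<alpha> \<beta> ` M)" for f
    using wandering_subspace[OF that] f2 by (metis eigenfunctional_linear(4) mult_zero_right)
  have "w \<in> generated_by (S_op \<alpha> \<beta>) (M \<ominus>\<^sub>H (S_op \<alpha> \<beta> ` M))"
    using w_in_M by (subst (asm) eq)
  moreover have "norm c < 1" using c by simp
  ultimately have "eigenfunctional c w = 0"
    using generated_by_eigenfunctional vanish by blast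
  moreover have "\<theta> c \<noteq> 0"
    using c assms by (intro \<theta>_nz) auto
  ultimately show False
    using c c_nz c_neq_\<mu> by (simp add: eigenfunctional_w)
qed

text \<open>
  The first summand is \<open>\<bar>\<tau>\<bar>\<^sup>2\<close>; the second is \<open>\<bar>\<tau>\<bar>\<^sup>2 * \<bar>g\<bar>\<^sup>2\<close>, as the Szego kernel has
  squared norm \<open>1 / (1 - \<bar>a\<bar>\<^sup>2)\<close>. In this form \<open>\<delta>\<close> is visibly continuous up to \<open>a = 1\<close>, where
  it equals \<open>1\<close>.
\<close>

lemma \<delta>_eq:
  "\<delta> = (norm (\<mu> - a) / norm (1 - cnj a * \<mu>))\<^sup>2 + (norm \<beta>)\<^sup>2 * (1 - (norm a)\<^sup>2) / (norm (1 - cnj a * \<mu>))\<^sup>2"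
proof -
  define s where "s = 1 - (norm a)\<^sup>2"
  have s: "s > 0" using a_disc by (simp add: s_def power_less_one_iff)
  have s': "1 - a * cnj a = of_real s"
    unfolding s_def by (simp only: of_real_diff of_real_1 complex_norm_square)
  define G where "G = \<beta> / \<tau> * (of_real s / (1 - cnj a * \<mu>))"
  have "hardy_inner szego szego = 1 / of_real s"
    using a_disc s' by (simp add: hardy_inner_szego szego mult.commute)
  hence "hardy_inner g g = G * cnj G / of_real s"
    by (simp add: g_def hardy_inner_linear G_def s' mult_ac)
  also have "\<dots> = of_real ((norm G)\<^sup>2 / s)"
    by (simp only: of_real_divide complex_norm_square)
  finally have "(norm g)\<^sup>2 = (norm G)\<^sup>2 / s"
    unfolding hardy_inner_self_norm of_real_eq_iff .
  also have "norm G = norm \<beta> / norm \<tau> * (s / norm (1 - cnj a * \<mu>))"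
    using s by (simp add: G_def norm_mult norm_divide)
  finally have "(norm \<tau>)\<^sup>2 * (norm g)\<^sup>2 = (norm \<beta>)\<^sup>2 * s / (norm (1 - cnj a * \<mu>))\<^sup>2"
    using s \<tau>_nz by (simp add: field_simps power2_eq_square)
  moreover have "norm \<tau> = norm (\<mu> - a) / norm (1 - cnj a * \<mu>)"
    by (simp add: \<tau>_def \<theta>_def norm_divide)
  ultimately show ?thesis
    by (simp add: \<delta>_def distrib_left s_def)
qed

end

section \<open>Moving the zero to the boundary\<close>

text \<open>
  With \<open>x = 1 / b - 4\<close>, the difference of the two sides is \<open>b\<^sup>3\<close> times the value of the cubic at
  \<open>x\<close>, and the cubic increases on the positive axis.
\<close>

lemma cubic_bound:
  assumes b: "0 < b" "b < 1 / (4 + cubic_root)"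
  shows "b * (2 - b)\<^sup>2 < 1 - b"
proof -
  define q where "q = (\<lambda>x::real. x ^ 3 + 7 * x ^ 2 + 12 * x - 1)"
  have root: "q cubic_root = 0"
    using theI'[OF cubic_root_unique] by (simp add: cubic_root_def q_def)
  have "\<exists>x\<ge>0. x \<le> 1 \<and> q x = 0"
    by (rule IVT) (auto simp: q_def)
  hence pos: "0 \<le> cubic_root"
    using cubic_root_unique root unfolding q_def by blast
  define x where "x = 1 / b - 4"
  have "cubic_root < x"
    using b pos by (simp add: x_def field_simps)
  hence "q cubic_root < q x"
    unfolding q_def using pos power_strict_mono[of cubic_root x 3] power_strict_mono[of cubic_root x 2]
    by simp
  hence "0 < b ^ 3 * q x"
    using root b by simp
  also have "b ^ 3 * q x = 1 - b - b * (2 - b)\<^sup>2"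
    using b by (simp add: q_def x_def power2_eq_square power3_eq_cube field_simps)
  finally show ?thesis by simp
qed

theorem theorem5p8:
  fixes \<alpha> \<beta> :: complex
  assumes "\<alpha> \<noteq> 0" and "\<beta> \<noteq> 0"
    and "(norm \<alpha>)\<^sup>2 + (norm \<beta>)\<^sup>2 = 1"
    and "(norm \<beta>)\<^sup>2 < 1 / (4 + cubic_root)"
  shows "\<exists>(a::complex) M.
           0 < norm a \<and> norm a < 1 \<and> a \<noteq> \<alpha> * cnj \<beta> \<and>
           closed_invariant_subspace \<alpha> \<beta> M \<and>
           has_associated_inner \<alpha> \<beta> M (\<lambda>z. (z - a) / (1 - cnj a * z)) \<and>
           M \<noteq> generated_by (S_op \<alpha> \<beta>) (M \<ominus>\<^sub>H (S_op \<alpha> \<beta> ` M))"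
proof -
  interpret unit_pair \<alpha> \<beta>
    using assms by unfold_locales auto
  \<comment> \<open>For the zero at the real point \<open>r\<close>, these are \<open>\<delta>\<close> and the modulus of \<open>c\<close>.\<close>
  define D :: "real \<Rightarrow> real" where
    "D = (\<lambda>r. (norm (\<mu> - of_real r) / norm (1 - of_real r * \<mu>))\<^sup>2 +
       (norm \<beta>)\<^sup>2 * (1 - r\<^sup>2) / (norm (1 - of_real r * \<mu>))\<^sup>2)"
  define F where "F = (\<lambda>r. norm (\<mu> + cnj \<beta> / (cnj \<alpha> * of_real (D r))))"
  have \<mu>1: "\<mu> \<noteq> 1" using norm_\<mu> by auto
  have D1: "D 1 = 1"
    using \<mu>1 by (simp add: D_def norm_minus_commute)
  have "isCont D 1"
    unfolding D_def using \<mu>1 by (intro continuous_intros) auto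
  hence cont: "isCont F 1"
    unfolding F_def using D1 \<alpha>_nz by (intro continuous_intros) auto
  have F1: "F 1 < 1"
  proof -
    define b where "b = (norm \<beta>)\<^sup>2"
    have b: "0 < b" "b < 1 / (4 + cubic_root)" "(norm \<alpha>)\<^sup>2 = 1 - b"
      using assms by (auto simp: b_def)
    have "\<mu> + cnj \<beta> / cnj \<alpha> = cnj \<beta> / cnj \<alpha> * of_real ((norm \<alpha>)\<^sup>2 + 1)"
      using \<alpha>_nz by (simp add: \<mu>_def complex_norm_square field_simps del: of_real_power)
    also have "norm \<dots> = norm \<beta> / norm \<alpha> * ((norm \<alpha>)\<^sup>2 + 1)"
      unfolding norm_mult norm_divide complex_mod_cnj norm_of_real by (simp add: add_nonneg_pos)
    finally have "(F 1)\<^sup>2 = b / (1 - b) * (2 - b)\<^sup>2"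
      using b by (simp add: F_def D1 power_mult_distrib power_divide b_def)
    moreover have "0 < (norm \<alpha>)\<^sup>2" using \<alpha>_nz by simp
    hence "1 - b > 0" using b by simp
    hence "b * (2 - b)\<^sup>2 / (1 - b) < 1"
      using cubic_bound[OF b(1,2)] by (simp add: pos_divide_less_eq)
    ultimately have "(F 1)\<^sup>2 < 1" by simp
    thus ?thesis
      by (simp add: F_def abs_square_less_1)
  qed
  have "(F \<longlongrightarrow> F 1) (at_left 1)"
    using continuous_at_imp_continuous_at_within[OF cont, of "{..<1}"]
    by (simp add: continuous_within)
  hence "((\<lambda>r. F r - r) \<longlongrightarrow> F 1 - 1) (at_left 1)"
    by (rule tendsto_diff) (rule tendsto_ident_at)
  hence "\<forall>\<^sub>F r in at_left 1. F r - r < 0"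
    by (rule order_tendstoD(2)) (use F1 in simp)
  hence "\<forall>\<^sub>F r in at_left 1. F r < r"
    by (rule eventually_mono) simp
  moreover have "\<forall>\<^sub>F r in at_left 1. r \<in> {norm \<mu><..<1}"
    by (rule eventually_at_left_real[OF norm_\<mu>])
  ultimately have "\<forall>\<^sub>F r in at_left 1. F r < r \<and> r \<in> {norm \<mu><..<1}"
    by (rule eventually_conj)
  then obtain r where r: "F r < r" "norm \<mu> < r" "r < 1"
    using eventually_happens' trivial_limit_at_left_real by fastforce
  have "0 < r" using r(2) norm_ge_zero[of \<mu>] by linarith
  have "norm \<mu> \<noteq> norm (complex_of_real r)" using r \<open>0 < r\<close> by simp
  hence neq: "complex_of_real r \<noteq> \<alpha> * cnj \<beta>"
    unfolding \<mu>_def by metis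
  interpret moebius_factor \<alpha> \<beta> "of_real r"
    using \<open>0 < r\<close> r neq by unfold_locales auto
  have "norm c < norm (complex_of_real r)"
    using r \<open>0 < r\<close> by (simp add: c_def \<delta>_eq F_def D_def)
  hence "M \<noteq> generated_by (S_op \<alpha> \<beta>) (M \<ominus>\<^sub>H (S_op \<alpha> \<beta> ` M))"
    by (rule not_generated)
  moreover have "has_associated_inner \<alpha> \<beta> M (\<lambda>z. (z - of_real r) / (1 - cnj (of_real r) * z))"
    using associated_inner unfolding \<theta>_def[abs_def] .
  ultimately show ?thesis
    using invariant_M neq r \<open>0 < r\<close>
    by (intro exI[of _ "complex_of_real r"] exI[of _ M]) auto
qed

end
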